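(* Let $\Theta$ be a non-empty finite signature consisting of unary predicate symbols and let $P$ be a symbol in $\Theta$. Let $A$ be a sentence of signature $\{<\}$ with $A\vdash{\sf LIN}$, let $U:=A+{\sf INF}$ (a theory of signature $\{<\}$), and let $\alpha^\star:=(A\wedge{\sf UB}(P))$, a sentence of signature $\{<\}+\Theta$. Then: (a) $\alpha^\star\vdash U$ and every model of $U$ can be expanded to a model of $\alpha^\star$. (b) For every sentence $\alpha$ of signature $\{<\}+\Theta$ such that $\alpha\vdash U$, we have $\alpha\blacktriangleright_{\sf pf}\alpha^\star$.
   Context: All signatures are purely relational; first-order logic with identity as a logical symbol. ${\sf LIN}$ is the theory, in the signature $\{<\}$, of (strict) linear order. ${\sf INF}$ is the theory in the language of identity that has, for every $n$, the axiom $\exists x_0\ldots\exists x_{n-1}\bigwedge_{i<j<n}x_i\neq x_j$. ${\sf UB}(P)$ says that $P$ defines a non-empty set that either has no maximal element or has no minimal element: $$\exists x\,P(x)\wedge\bigl(\forall y\,(P(y)\to\exists z\,(P(z)\wedge y<z))\ \vee\ \forall y\,(P(y)\to\exists z\,(P(z)\wedge z<y))\bigr).$$ Parameter-free interpretability preserving $<$: a parameter-free translation $\tau$ sends each predicate symbol $Q$ of $\Theta$ to a formula $\tau(Q)(v)$ of signature $\{<\}+\Theta$ with at most the variable $v$ free. It is lifted to all formulas of signature $\{<\}+\Theta$ by putting $Q^\tau(x):=\tau(Q)(x)$ for $Q\in\Theta$ (renaming bound variables if needed), leaving $<$ and identity unchanged, and commuting with connectives and (unrelativized) quantifiers. For theories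 $V,W$ of signature $\{<\}+\Theta$, $W\blacktriangleright_{\sf pf}V$ means that there is such a $\tau$ with: for all sentences $\gamma$ of signature $\{<\}+\Theta$, if $V\vdash\gamma$ then $W\vdash\gamma^\tau$. A sentence is identified with the theory it axiomatizes. *)

theory Defs
  imports Main
begin

section \<open>First-order logic over a binary symbol and unary predicate symbols\<close>

text \<open>
  The formulas over the binary symbol \<open><\<close>, identity, and unary predicate symbols taken from the
  type \<open>'p\<close>. The type \<open>'p\<close> is only a supply of symbols; a signature \<open>{<} + \<Sigma>\<close> is given by a
  set \<open>\<Sigma> :: 'p set\<close>, and the signature \<open>{<}\<close> is the case \<open>\<Sigma> = {}\<close>.
  Variables are de Bruijn indices: the variable \<open>0\<close> is bound by the innermost quantifier.
\<close>

datatype 'p fm =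
    Bot
  | Eq nat nat
  | Less nat nat
  | Pred 'p nat
  | Imp "'p fm" "'p fm"
  | All "'p fm"

abbreviation Neg :: "'p fm \<Rightarrow> 'p fm" where
  "Neg \<phi> \<equiv> Imp \<phi> Bot"

abbreviation Top :: "'p fm" where
  "Top \<equiv> Neg Bot"

abbreviation And :: "'p fm \<Rightarrow> 'p fm \<Rightarrow> 'p fm" where
  "And \<phi> \<psi> \<equiv> Neg (Imp \<phi> (Neg \<psi>))"

abbreviation Or :: "'p fm \<Rightarrow> 'p fm \<Rightarrow> 'p fm" where
  "Or \<phi> \<psi> \<equiv> Imp (Neg \<phi>) \<psi>"

abbreviation Ex :: "'p fm \<Rightarrow> 'p fm" where
  "Ex \<phi> \<equiv> Neg (All (Neg \<phi>))"

primrec fv :: "'p fm \<Rightarrow> nat set" where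
  "fv Bot = {}"
| "fv (Eq x y) = {x, y}"
| "fv (Less x y) = {x, y}"
| "fv (Pred Q x) = {x}"
| "fv (Imp \<phi> \<psi>) = fv \<phi> \<union> fv \<psi>"
| "fv (All \<phi>) = {x. Suc x \<in> fv \<phi>}"

primrec preds :: "'p fm \<Rightarrow> 'p set" where
  "preds Bot = {}"
| "preds (Eq x y) = {}"
| "preds (Less x y) = {}"
| "preds (Pred Q x) = {Q}"
| "preds (Imp \<phi> \<psi>) = preds \<phi> \<union> preds \<psi>"
| "preds (All \<phi>) = preds \<phi>"

definition sentence :: "'p set \<Rightarrow> 'p fm \<Rightarrow> bool" where
  "sentence \<Sigma> \<phi> \<longleftrightarrow> preds \<phi> \<subseteq> \<Sigma> \<and> fv \<phi> = {}"

text \<open>Simultaneous replacement of the free variables of a formula by variables, avoiding capture.\<close>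

primrec ren :: "(nat \<Rightarrow> nat) \<Rightarrow> 'p fm \<Rightarrow> 'p fm" where
  "ren f Bot = Bot"
| "ren f (Eq x y) = Eq (f x) (f y)"
| "ren f (Less x y) = Less (f x) (f y)"
| "ren f (Pred Q x) = Pred Q (f x)"
| "ren f (Imp \<phi> \<psi>) = Imp (ren f \<phi>) (ren f \<psi>)"
| "ren f (All \<phi>) = All (ren (case_nat 0 (Suc \<circ> f)) \<phi>)"

text \<open>
  \<open>inst x \<phi>\<close> is the formula \<open>\<phi>(x)\<close>: the variable \<open>0\<close> is replaced by \<open>x\<close>, and the other
  free variables are lowered by one, since the binder of \<open>0\<close> disappears.
\<close>

definition inst :: "nat \<Rightarrow> 'p fm \<Rightarrow> 'p fm" where
  "inst x = ren (case_nat x (\<lambda>n. n))"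


section \<open>Provability\<close>

text \<open>
  Classical natural deduction with identity. In the rule \<open>AllI\<close> shifting the
  hypotheses by \<open>Suc\<close> makes the variable \<open>0\<close> fresh for them (the eigenvariable condition).
\<close>

inductive derives :: "'p fm set \<Rightarrow> 'p fm \<Rightarrow> bool" (infix \<open>\<turnstile>\<close> 50) where
  Assm: "\<phi> \<in> \<Gamma> \<Longrightarrow> \<Gamma> \<turnstile> \<phi>"
| ImpI: "insert \<phi> \<Gamma> \<turnstile> \<psi> \<Longrightarrow> \<Gamma> \<turnstile> Imp \<phi> \<psi>"
| ImpE: "\<Gamma> \<turnstile> Imp \<phi> \<psi> \<Longrightarrow> \<Gamma> \<turnstile> \<phi> \<Longrightarrow> \<Gamma> \<turnstile> \<psi>"
| Contr: "insert (Neg \<phi>) \<Gamma> \<turnstile> Bot \<Longrightarrow> \<Gamma> \<turnstile> \<phi>"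
| AllI: "ren Suc ` \<Gamma> \<turnstile> \<phi> \<Longrightarrow> \<Gamma> \<turnstile> All \<phi>"
| AllE: "\<Gamma> \<turnstile> All \<phi> \<Longrightarrow> \<Gamma> \<turnstile> inst x \<phi>"
| EqRefl: "\<Gamma> \<turnstile> Eq x x"
| EqSubst: "\<Gamma> \<turnstile> Eq x y \<Longrightarrow> \<Gamma> \<turnstile> inst x \<phi> \<Longrightarrow> \<Gamma> \<turnstile> inst y \<phi>"

definition derives_theory :: "'p fm set \<Rightarrow> 'p fm set \<Rightarrow> bool" (infix \<open>\<tturnstile>\<close> 50) where
  "V \<tturnstile> W \<longleftrightarrow> (\<forall>\<phi>\<in>W. V \<turnstile> \<phi>)"


section \<open>Structures\<close>

text \<open>A structure interprets exactly the predicate symbols in the domain of the partial map \<open>prd\<close>.\<close>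

record ('p, 'm) struct =
  univ :: "'m set"
  lt :: "('m \<times> 'm) set"
  prd :: "'p \<rightharpoonup> 'm set"

definition is_struct :: "'p set \<Rightarrow> ('p, 'm) struct \<Rightarrow> bool" where
  "is_struct \<Sigma> M \<longleftrightarrow> univ M \<noteq> {} \<and> lt M \<subseteq> univ M \<times> univ M \<and>
     dom (prd M) = \<Sigma> \<and> (\<forall>X\<in>ran (prd M). X \<subseteq> univ M)"

primrec sat :: "('p, 'm) struct \<Rightarrow> (nat \<Rightarrow> 'm) \<Rightarrow> 'p fm \<Rightarrow> bool" where
  "sat M e Bot = False"
| "sat M e (Eq x y) = (e x = e y)"
| "sat M e (Less x y) = ((e x, e y) \<in> lt M)"
| "sat M e (Pred Q x) = (e x \<in> the (prd M Q))"
| "sat M e (Imp \<phi> \<psi>) = (sat M e \<phi> \<longrightarrow> sat M e \<psi>)"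
| "sat M e (All \<phi>) = (\<forall>a\<in>univ M. sat M (case_nat a e) \<phi>)"

text \<open>
  Used below only for sets \<open>T\<close> of sentences of signature \<open>{<} + \<Sigma>\<close>, for which the
  assignment is irrelevant.
\<close>

definition is_model :: "'p set \<Rightarrow> ('p, 'm) struct \<Rightarrow> 'p fm set \<Rightarrow> bool" where
  "is_model \<Sigma> M T \<longleftrightarrow> is_struct \<Sigma> M \<and> (\<forall>\<phi>\<in>T. \<forall>e. range e \<subseteq> univ M \<longrightarrow> sat M e \<phi>)"

definition expands_to :: "('p, 'm) struct \<Rightarrow> ('p, 'm) struct \<Rightarrow> bool" where
  "expands_to M N \<longleftrightarrow> univ N = univ M \<and> lt N = lt M \<and> prd M \<subseteq>\<^sub>m prd N"


section \<open>Interpretability\<close>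

text \<open>The variable \<open>v\<close> of \<open>\<tau>(Q)(v)\<close> is the index \<open>0\<close>.\<close>

definition pf_translation :: "'p set \<Rightarrow> ('p \<Rightarrow> 'p fm) \<Rightarrow> bool" where
  "pf_translation \<Theta> \<tau> \<longleftrightarrow> (\<forall>Q\<in>\<Theta>. preds (\<tau> Q) \<subseteq> \<Theta> \<and> fv (\<tau> Q) \<subseteq> {0})"

primrec translate :: "('p \<Rightarrow> 'p fm) \<Rightarrow> 'p fm \<Rightarrow> 'p fm" where
  "translate \<tau> Bot = Bot"
| "translate \<tau> (Eq x y) = Eq x y"
| "translate \<tau> (Less x y) = Less x y"
| "translate \<tau> (Pred Q x) = inst x (\<tau> Q)"
| "translate \<tau> (Imp \<phi> \<psi>) = Imp (translate \<tau> \<phi>) (translate \<tau> \<psi>)"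
| "translate \<tau> (All \<phi>) = All (translate \<tau> \<phi>)"

definition pf_interprets :: "'p set \<Rightarrow> 'p fm set \<Rightarrow> 'p fm set \<Rightarrow> bool" where
  "pf_interprets \<Theta> W V \<longleftrightarrow> (\<exists>\<tau>. pf_translation \<Theta> \<tau> \<and>
     (\<forall>\<gamma>. sentence \<Theta> \<gamma> \<longrightarrow> V \<turnstile> \<gamma> \<longrightarrow> W \<turnstile> translate \<tau> \<gamma>))"


section \<open>The theories\<close>

definition LIN_ax :: "'p fm set" where
  "LIN_ax = {
     All (Neg (Less 0 0)),
     All (All (All (Imp (And (Less 2 1) (Less 1 0)) (Less 2 0)))),
     All (All (Or (Less 1 0) (Or (Eq 1 0) (Less 0 1))))}"

primrec Conj :: "'p fm list \<Rightarrow> 'p fm" where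
  "Conj [] = Top"
| "Conj (\<phi> # \<phi>s) = And \<phi> (Conj \<phi>s)"

text \<open>Below the quantifiers \<open>\<exists>x\<^sub>0 \<dots> \<exists>x\<^bsub>n-1\<^esub>\<close> the variable \<open>x\<^sub>i\<close> is the index \<open>n - Suc i\<close>.\<close>

definition at_least :: "nat \<Rightarrow> 'p fm" where
  "at_least n = (Ex ^^ n) (Conj [Neg (Eq (n - Suc i) (n - Suc j)). j \<leftarrow> [0..<n], i \<leftarrow> [0..<j]])"

definition INF_ax :: "'p fm set" where
  "INF_ax = range at_least"

definition UB :: "'p \<Rightarrow> 'p fm" where
  "UB P = And (Ex (Pred P 0))
     (Or (All (Imp (Pred P 0) (Ex (And (Pred P 0) (Less 1 0)))))
         (All (Imp (Pred P 0) (Ex (And (Pred P 0) (Less 0 1))))))"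

end

theory Submission
  imports Defs "HOL-Library.Countable_Set"
begin

text \<open>
  By completeness it suffices to argue about models. An infinite linear order contains a set
  without maximum or without minimum, which gives the expansion in (a). For (b), let \<open>n\<close> be the
  quantifier rank of \<open>\<alpha>\<close> and let \<open>D\<close> be the definable set of points \<open>v\<close> of a model of \<open>\<alpha>\<close> such
  that the initial segment up to \<open>v\<close> is equivalent, up to rank \<open>n\<close>, to a finite labelled order.
  If the universe, \<open>D\<close>, and the set of upper bounds of \<open>D\<close> are each empty or have both endpoints,
  then \<open>D\<close> has a maximum; it has no successor, since adding a top point preserves equivalence to
  a finite order, so it is the last point and \<open>\<alpha>\<close> has a finite model. Hence in every model
  of \<open>\<alpha>\<close> one of these three sets is unbounded, and a single formula defines the first that is.
\<close>

section \<open>Syntax\<close>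

lemma finite_fv: "finite (fv \<phi>)"
proof (induction \<phi>)
  case (All \<phi>)
  have "{x. Suc x \<in> fv \<phi>} = Suc -` fv \<phi>" by auto
  then show ?case using All by (simp add: finite_vimageI)
qed auto

lemma ren_cong: "(\<And>x. x \<in> fv \<phi> \<Longrightarrow> f x = g x) \<Longrightarrow> ren f \<phi> = ren g \<phi>"
proof (induction \<phi> arbitrary: f g)
  case (All \<phi>)
  have "ren (case_nat 0 (Suc \<circ> f)) \<phi> = ren (case_nat 0 (Suc \<circ> g)) \<phi>"
    using All.prems by (intro All.IH) (auto split: nat.split)
  then show ?case by simp
next
  case (Imp \<phi> \<psi>)
  from Imp.IH[of f g] Imp.prems show ?case by simp
qed auto

lemma ren_id [simp]: "ren (\<lambda>x. x) \<phi> = \<phi>"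
proof (induction \<phi>)
  case (All \<phi>)
  have "case_nat 0 (Suc \<circ> (\<lambda>x. x)) = (\<lambda>x. x)" by (auto split: nat.split)
  then show ?case using All by simp
qed auto

lemma ren_ren: "ren f (ren g \<phi>) = ren (f \<circ> g) \<phi>"
proof (induction \<phi> arbitrary: f g)
  case (All \<phi>)
  have "case_nat 0 (Suc \<circ> f) \<circ> case_nat 0 (Suc \<circ> g) = case_nat 0 (Suc \<circ> (f \<circ> g))"
    by (auto split: nat.split)
  then show ?case by (simp only: ren.simps All.IH)
qed auto

text \<open>The substitution lemma that keeps the rules \<open>AllE\<close> and
  \<open>EqSubst\<close> valid under renaming.\<close>

lemma ren_inst: "ren f (inst x \<phi>) = inst (f x) (ren (case_nat 0 (Suc \<circ> f)) \<phi>)"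
  unfolding inst_def ren_ren by (rule ren_cong) (auto split: nat.split)

lemma inst_ren: "inst x (ren (case_nat 0 (Suc \<circ> f)) \<phi>) = ren (case_nat x f) \<phi>"
  unfolding inst_def ren_ren by (rule ren_cong) (auto split: nat.split)

lemma preds_ren [simp]: "preds (ren f \<phi>) = preds \<phi>"
  by (induction \<phi> arbitrary: f) auto

lemma preds_inst [simp]: "preds (inst x \<phi>) = preds \<phi>"
  by (simp add: inst_def)

text \<open>The type \<open>'p\<close> may be uncountable, so the count is restricted to formulas
  over \<Sigma> and runs by induction on a bound for the size.\<close>

lemma countable_fm:
  assumes "countable \<Sigma>"
  shows "countable {\<phi>. preds \<phi> \<subseteq> \<Sigma>}"
proof -
  have "{\<phi>. preds \<phi> \<subseteq> \<Sigma>} \<subseteq> (\<Union>n. {\<phi>. preds \<phi> \<subseteq> \<Sigma> \<and> size \<phi> \<le> n})" by auto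
  moreover have "countable {\<phi>. preds \<phi> \<subseteq> \<Sigma> \<and> size \<phi> \<le> n}" for n
  proof (induction n)
    case 0
    let ?B = "{Bot} \<union> (\<lambda>(x,y). Eq x y) ` UNIV \<union> (\<lambda>(x,y). Less x y) ` UNIV
       \<union> (\<lambda>(Q,x). Pred Q x) ` (\<Sigma> \<times> UNIV)"
    have "{\<phi>. preds \<phi> \<subseteq> \<Sigma> \<and> size \<phi> \<le> 0} \<subseteq> ?B"
    proof
      fix \<phi> assume "\<phi> \<in> {\<phi>. preds \<phi> \<subseteq> \<Sigma> \<and> size \<phi> \<le> 0}"
      then show "\<phi> \<in> ?B" by (cases \<phi>) auto
    qed
    moreover have "countable ?B" using assms by auto
    ultimately show ?case by (rule countable_subset)
  next
    case (Suc n)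
    let ?F = "{\<phi>. preds \<phi> \<subseteq> \<Sigma> \<and> size \<phi> \<le> n}"
    let ?B = "?F \<union> {Bot} \<union> (\<lambda>(x,y). Eq x y) ` UNIV \<union> (\<lambda>(x,y). Less x y) ` UNIV
       \<union> (\<lambda>(Q,x). Pred Q x) ` (\<Sigma> \<times> UNIV) \<union> (\<lambda>(\<phi>,\<psi>). Imp \<phi> \<psi>) ` (?F \<times> ?F) \<union> All ` ?F"
    have "{\<phi>. preds \<phi> \<subseteq> \<Sigma> \<and> size \<phi> \<le> Suc n} \<subseteq> ?B"
    proof
      fix \<phi> assume "\<phi> \<in> {\<phi>. preds \<phi> \<subseteq> \<Sigma> \<and> size \<phi> \<le> Suc n}"
      then show "\<phi> \<in> ?B" by (cases \<phi>) auto
    qed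
    moreover have "countable ?B" using assms Suc by auto
    ultimately show ?case by (rule countable_subset)
  qed
  ultimately show ?thesis by (auto intro: countable_subset)
qed


section \<open>Derivations\<close>

lemma weakening: "\<Gamma> \<turnstile> \<phi> \<Longrightarrow> \<Gamma> \<subseteq> \<Delta> \<Longrightarrow> \<Delta> \<turnstile> \<phi>"
proof (induction arbitrary: \<Delta> rule: derives.induct)
  case (ImpI \<phi> \<Gamma> \<psi>)
  from ImpI.prems show ?case by (intro derives.ImpI ImpI.IH) auto
next
  case (Contr \<phi> \<Gamma>)
  from Contr.prems show ?case by - (rule derives.Contr[OF Contr.IH], auto)
next
  case (AllI \<Gamma> \<phi>)
  from AllI.prems show ?case by (intro derives.AllI AllI.IH) auto
next
  case (Assm \<phi> \<Gamma>)
  then show ?case by (intro derives.Assm) auto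
next
  case (ImpE \<Gamma> \<phi> \<psi>)
  from ImpE.prems show ?case by (intro derives.ImpE[of _ \<phi> \<psi>] ImpE.IH)
next
  case (AllE \<Gamma> \<phi> x)
  from AllE.prems show ?case by (intro derives.AllE AllE.IH)
next
  case (EqRefl \<Gamma> x)
  show ?case by (rule derives.EqRefl)
next
  case (EqSubst \<Gamma> x y \<phi>)
  from EqSubst.prems show ?case by (intro derives.EqSubst[of _ x y \<phi>] EqSubst.IH)
qed

text \<open>In the \<open>AllI\<close> case the renaming lifted under the binder commutes with the
  shift \<open>Suc\<close> of the hypotheses. The lemma serves to trade that shift for a named fresh
  variable.\<close>

lemma derives_ren: "\<Gamma> \<turnstile> \<phi> \<Longrightarrow> ren f ` \<Gamma> \<turnstile> ren f \<phi>"
proof (induction arbitrary: f rule: derives.induct)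
  case (AllI \<Gamma> \<phi>)
  let ?g = "case_nat 0 (Suc \<circ> f)"
  have "ren ?g ` ren Suc ` \<Gamma> = ren Suc ` ren f ` \<Gamma>"
    by (auto simp: image_image ren_ren intro!: image_cong ren_cong)
  with AllI.IH[of ?g] show ?case by (auto intro: derives.AllI)
next
  case (AllE \<Gamma> \<phi> x)
  have "ren f ` \<Gamma> \<turnstile> All (ren (case_nat 0 (Suc \<circ> f)) \<phi>)" using AllE.IH[of f] by simp
  then show ?case unfolding ren_inst by (rule derives.AllE)
next
  case (EqSubst \<Gamma> x y \<phi>)
  from EqSubst.IH[of f] show ?case unfolding ren_inst by (auto intro: derives.EqSubst)
next
  case (Contr \<phi> \<Gamma>)
  from Contr.IH[of f] show ?case by (intro derives.Contr[of "ren f \<phi>"]) simp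
qed (auto intro: Assm ImpI ImpE EqRefl)

text \<open>Compactness of derivations: a union of a chain of consistent sets stays
  consistent.\<close>

lemma finite_support:
  "\<Gamma> \<turnstile> \<phi> \<Longrightarrow> \<exists>\<Gamma>0 \<subseteq> \<Gamma>. finite \<Gamma>0 \<and> \<Gamma>0 \<turnstile> \<phi>"
proof (induction rule: derives.induct)
  case (Assm \<phi> \<Gamma>)
  then show ?case by (intro exI[of _ "{\<phi>}"]) (auto intro: derives.Assm)
next
  case (ImpI \<phi> \<Gamma> \<psi>)
  then obtain D where D: "D \<subseteq> insert \<phi> \<Gamma>" "finite D" "D \<turnstile> \<psi>" by blast
  then have "D - {\<phi>} \<turnstile> Imp \<phi> \<psi>" by (intro derives.ImpI) (rule weakening, auto)
  with D show ?case by (intro exI[of _ "D - {\<phi>}"]) auto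
next
  case (ImpE \<Gamma> \<phi> \<psi>)
  then obtain D E where D: "D \<subseteq> \<Gamma>" "finite D" "D \<turnstile> Imp \<phi> \<psi>"
    and E: "E \<subseteq> \<Gamma>" "finite E" "E \<turnstile> \<phi>"
    by blast
  have "D \<union> E \<turnstile> \<psi>"
    using weakening[OF D(3)] weakening[OF E(3)] by (intro derives.ImpE[of _ \<phi> \<psi>]) auto
  with D E show ?case by (intro exI[of _ "D \<union> E"]) auto
next
  case (Contr \<phi> \<Gamma>)
  then obtain D where D: "D \<subseteq> insert (Neg \<phi>) \<Gamma>" "finite D" "D \<turnstile> Bot" by blast
  then have "D - {Neg \<phi>} \<turnstile> \<phi>" by - (rule derives.Contr[OF weakening], auto)
  with D show ?case by (intro exI[of _ "D - {Neg \<phi>}"]) auto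
next
  case (AllI \<Gamma> \<phi>)
  then obtain D where D: "D \<subseteq> ren Suc ` \<Gamma>" "finite D" "D \<turnstile> \<phi>" by blast
  then obtain E where "E \<subseteq> \<Gamma>" "finite E" "D = ren Suc ` E"
    using finite_subset_image[OF D(2,1)] by blast
  with D show ?case using derives.AllI[of E \<phi>] by auto
next
  case (AllE \<Gamma> \<phi> x)
  then show ?case using derives.AllE by metis
next
  case (EqRefl \<Gamma> x)
  show ?case by (intro exI[of _ "{}"]) (auto intro: derives.EqRefl)
next
  case (EqSubst \<Gamma> x y \<phi>)
  then obtain D E where D: "D \<subseteq> \<Gamma>" "finite D" "D \<turnstile> Eq x y"
    and E: "E \<subseteq> \<Gamma>" "finite E" "E \<turnstile> inst x \<phi>"
    by blast
  have "D \<union> E \<turnstile> inst y \<phi>"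
    using weakening[OF D(3)] weakening[OF E(3)] by (intro derives.EqSubst[of _ x y \<phi>]) auto
  with D E show ?case by (intro exI[of _ "D \<union> E"]) auto
qed

text \<open>The renaming \<open>?g\<close> undoes the instantiation of \<open>0\<close> by
  \<open>x\<close>. On the hypotheses, where \<open>x\<close> does not occur, it acts as
  \<open>Suc\<close>, so \<open>AllI\<close> applies to the renamed derivation.\<close>

lemma AllI_fresh:
  assumes "\<Gamma> \<turnstile> inst x \<phi>" "x \<notin> fv (All \<phi>)" "\<And>\<psi>. \<psi> \<in> \<Gamma> \<Longrightarrow> x \<notin> fv \<psi>"
  shows "\<Gamma> \<turnstile> All \<phi>"
proof -
  let ?g = "\<lambda>y. if y = x then 0 else Suc y"
  have "ren ?g ` \<Gamma> = ren Suc ` \<Gamma>"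
    using assms(3) by (intro image_cong refl ren_cong) auto
  moreover have "ren ?g (inst x \<phi>) = ren (\<lambda>x. x) \<phi>"
    unfolding inst_def ren_ren using assms(2) by (intro ren_cong) (auto split: nat.split)
  ultimately show ?thesis
    using derives_ren[OF assms(1), of ?g] by (auto intro: AllI)
qed

lemma explosion: "\<Gamma> \<turnstile> Bot \<Longrightarrow> \<Gamma> \<turnstile> \<phi>"
  by (rule Contr[OF weakening]) auto

lemma Eq_sym:
  assumes "\<Gamma> \<turnstile> Eq x y" shows "\<Gamma> \<turnstile> Eq y x"
  \<comment> \<open>In the template \<open>0\<close> marks the place to be replaced; the fixed
    variable is written \<open>Suc x\<close> because \<open>inst\<close> lowers it to
    \<open>x\<close>.\<close>
  using EqSubst[OF assms, of "Eq 0 (Suc x)"] EqRefl[of \<Gamma> x] by (simp add: inst_def)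

lemma Eq_trans:
  assumes "\<Gamma> \<turnstile> Eq x y" "\<Gamma> \<turnstile> Eq y z" shows "\<Gamma> \<turnstile> Eq x z"
  using EqSubst[OF assms(2), of "Eq (Suc x) 0"] assms(1) by (auto simp: inst_def)

lemma Less_subst:
  assumes "\<Gamma> \<turnstile> Eq x x'" "\<Gamma> \<turnstile> Eq y y'" "\<Gamma> \<turnstile> Less x y" shows "\<Gamma> \<turnstile> Less x' y'"
  using EqSubst[OF assms(1), of "Less 0 (Suc y)"] EqSubst[OF assms(2), of "Less (Suc x') 0"] assms(3)
  by (auto simp: inst_def)

lemma Pred_subst:
  assumes "\<Gamma> \<turnstile> Eq x x'" "\<Gamma> \<turnstile> Pred Q x" shows "\<Gamma> \<turnstile> Pred Q x'"
  using EqSubst[OF assms(1), of "Pred Q 0"] assms(2) by (auto simp: inst_def)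


section \<open>Soundness\<close>

lemma sat_cong: "(\<And>x. x \<in> fv \<phi> \<Longrightarrow> e x = f x) \<Longrightarrow> sat M e \<phi> = sat M f \<phi>"
proof (induction \<phi> arbitrary: e f)
  case (All \<phi>)
  have "sat M (case_nat a e) \<phi> = sat M (case_nat a f) \<phi>" for a
    using All.prems by (intro All.IH) (auto split: nat.split)
  then show ?case by simp
next
  case (Imp \<phi> \<psi>)
  from Imp.IH[of e f] Imp.prems show ?case by simp
qed auto

lemma sat_ren: "sat M e (ren f \<phi>) = sat M (e \<circ> f) \<phi>"
proof (induction \<phi> arbitrary: e f)
  case (All \<phi>)
  have "case_nat a e \<circ> case_nat 0 (Suc \<circ> f) = case_nat a (e \<circ> f)" for a
    by (auto split: nat.split)
  then show ?case by (simp only: sat.simps ren.simps All.IH)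
qed auto

lemma sat_inst: "sat M e (inst x \<phi>) = sat M (case_nat (e x) e) \<phi>"
  unfolding inst_def sat_ren by (rule sat_cong) (auto split: nat.split)

lemma sat_reduct: "preds \<phi> = {} \<Longrightarrow> sat (M\<lparr>prd := I\<rparr>) e \<phi> = sat M e \<phi>"
  by (induction \<phi> arbitrary: e) auto

text \<open>The statement covers all records \<open>M\<close>, so that it also applies to words and
  to the total interpretations that arise from translations.\<close>

theorem soundness:
  "\<Gamma> \<turnstile> \<phi> \<Longrightarrow> range e \<subseteq> univ M \<Longrightarrow> \<forall>\<psi>\<in>\<Gamma>. sat M e \<psi> \<Longrightarrow> sat M e \<phi>"
proof (induction arbitrary: e rule: derives.induct)
  case (Contr \<phi> \<Gamma>)
  then show ?case by fastforce
next
  case (AllI \<Gamma> \<phi>)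
  have "sat M (case_nat a e) \<phi>" if "a \<in> univ M" for a
  proof (rule AllI.IH)
    show "range (case_nat a e) \<subseteq> univ M"
      using AllI.prems(1) that by (auto simp: subset_iff split: nat.splits)
    have "case_nat a e \<circ> Suc = e" by auto
    then show "\<forall>\<psi>\<in>ren Suc ` \<Gamma>. sat M (case_nat a e) \<psi>"
      using AllI.prems(2) by (auto simp: sat_ren)
  qed
  then show ?case by simp
next
  case (AllE \<Gamma> \<phi> x)
  from AllE.IH[OF AllE.prems] AllE.prems(1) show ?case by (simp add: sat_inst range_subsetD)
next
  case (EqSubst \<Gamma> x y \<phi>)
  from EqSubst.IH(1)[OF EqSubst.prems] EqSubst.IH(2)[OF EqSubst.prems] show ?case
    by (simp add: sat_inst)
qed auto


section \<open>Completeness\<close>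

text \<open>Variables play the role of Henkin constants: a fresh one exists as long as only finitely
  many occur free. The set is empty unless \<open>\<phi>\<close> is a negated universal
  formula.\<close>

definition witness :: "'p fm \<Rightarrow> 'p fm set \<Rightarrow> 'p fm set" where
  "witness \<phi> \<Gamma> = {Neg (inst (SOME x. x \<notin> fv \<phi> \<union> \<Union> (fv ` \<Gamma>)) \<psi>) | \<psi>. \<phi> = Neg (All \<psi>)}"

primrec henkin :: "(nat \<Rightarrow> 'p fm) \<Rightarrow> 'p fm set \<Rightarrow> nat \<Rightarrow> 'p fm set" where
  "henkin en \<Gamma> 0 = \<Gamma>"
| "henkin en \<Gamma> (Suc n) =
    (if insert (en n) (henkin en \<Gamma> n) \<turnstile> Bot then henkin en \<Gamma> n
     else insert (en n) (witness (en n) (henkin en \<Gamma> n) \<union> henkin en \<Gamma> n))"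

lemma witness_cases:
  obtains "witness \<phi> \<Gamma> = {}" |
    \<psi> where "\<phi> = Neg (All \<psi>)"
      "witness \<phi> \<Gamma> = {Neg (inst (SOME x. x \<notin> fv \<phi> \<union> \<Union> (fv ` \<Gamma>)) \<psi>)}"
  unfolding witness_def by blast

lemma finite_witness: "finite (witness \<phi> \<Gamma>)"
  by (rule witness_cases[of \<phi> \<Gamma>]) auto

text \<open>If the witness \<open>x\<close> caused an inconsistency, the instance at
  \<open>x\<close> would be derivable; as \<open>x\<close> is fresh, the universal formula would be
  derivable too, against its accepted negation.\<close>

lemma consistent_witness:
  assumes "finite (\<Union> (fv ` \<Gamma>))" "\<not> insert \<phi> \<Gamma> \<turnstile> Bot"
  shows "\<not> insert \<phi> (witness \<phi> \<Gamma> \<union> \<Gamma>) \<turnstile> Bot"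
proof (rule witness_cases[of \<phi> \<Gamma>])
  assume "witness \<phi> \<Gamma> = {}"
  then show ?thesis using assms by simp
next
  fix \<psi> define x where "x = (SOME x. x \<notin> fv \<phi> \<union> \<Union> (fv ` \<Gamma>))"
  assume \<phi>: "\<phi> = Neg (All \<psi>)"
    and w: "witness \<phi> \<Gamma> = {Neg (inst (SOME x. x \<notin> fv \<phi> \<union> \<Union> (fv ` \<Gamma>)) \<psi>)}"
  have "\<exists>x. x \<notin> fv \<phi> \<union> \<Union> (fv ` \<Gamma>)"
    using ex_new_if_finite[OF infinite_UNIV_nat] assms(1) finite_fv by blast
  then have x: "x \<notin> fv \<phi> \<union> \<Union> (fv ` \<Gamma>)" unfolding x_def by (rule someI_ex)
  show ?thesis
  proof
    assume "insert \<phi> (witness \<phi> \<Gamma> \<union> \<Gamma>) \<turnstile> Bot"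
    then have "insert (Neg (inst x \<psi>)) (insert \<phi> \<Gamma>) \<turnstile> Bot"
      unfolding w x_def by (simp add: insert_commute)
    then have "insert \<phi> \<Gamma> \<turnstile> inst x \<psi>" by (rule Contr)
    then have "insert \<phi> \<Gamma> \<turnstile> All \<psi>" by (rule AllI_fresh) (use x in \<open>auto simp: \<phi>\<close>)
    moreover have "insert \<phi> \<Gamma> \<turnstile> Neg (All \<psi>)" by (auto simp: \<phi> intro: Assm)
    ultimately show False using assms(2) ImpE[of _ "All \<psi>" Bot] by blast
  qed
qed

lemma finite_fv_henkin: "finite (\<Union> (fv ` \<Gamma>)) \<Longrightarrow> finite (\<Union> (fv ` henkin en \<Gamma> n))"
  by (induction n) (auto simp: finite_witness finite_fv)

lemma consistent_henkin:
  "finite (\<Union> (fv ` \<Gamma>)) \<Longrightarrow> \<not> \<Gamma> \<turnstile> Bot \<Longrightarrow> \<not> henkin en \<Gamma> n \<turnstile> Bot"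
  by (induction n) (auto simp: consistent_witness finite_fv_henkin)

lemma henkin_mono: "m \<le> n \<Longrightarrow> henkin en \<Gamma> m \<subseteq> henkin en \<Gamma> n"
  by (rule lift_Suc_mono_le) auto

text \<open>A derivation of \<open>Bot\<close> uses finitely many hypotheses, and these already lie
  in a single stage of the chain.\<close>

lemma consistent_henkin_union:
  assumes "finite (\<Union> (fv ` \<Gamma>))" "\<not> \<Gamma> \<turnstile> Bot"
  shows "\<not> (\<Union>n. henkin en \<Gamma> n) \<turnstile> Bot"
proof
  assume "(\<Union>n. henkin en \<Gamma> n) \<turnstile> Bot"
  then obtain D where D: "D \<subseteq> (\<Union>n. henkin en \<Gamma> n)" "finite D" "D \<turnstile> Bot"
    using finite_support by blast
  from D(2,1) have "\<exists>n. D \<subseteq> henkin en \<Gamma> n"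
  proof (induction rule: finite_induct)
    case (insert x F)
    then obtain m n where "F \<subseteq> henkin en \<Gamma> n" "x \<in> henkin en \<Gamma> m" by auto
    then have "insert x F \<subseteq> henkin en \<Gamma> (max m n)"
      using henkin_mono[of m "max m n" en \<Gamma>] henkin_mono[of n "max m n" en \<Gamma>] by auto
    then show ?case ..
  qed simp
  with D(3) show False using consistent_henkin[OF assms] weakening[OF D(3)] by blast
qed

text \<open>The Henkin construction with the variables as terms: the model consists of variables
  modulo provable equality.\<close>

theorem model_existence:
  fixes \<Gamma> :: "'p fm set"
  assumes \<Sigma>: "countable \<Sigma>" and \<Gamma>: "\<And>\<phi>. \<phi> \<in> \<Gamma> \<Longrightarrow> sentence \<Sigma> \<phi>" and con: "\<not> \<Gamma> \<turnstile> Bot"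
  shows "\<exists>M :: ('p, nat) struct. is_model \<Sigma> M \<Gamma>"
proof -
  define en where "en = from_nat_into {\<phi>. preds \<phi> \<subseteq> \<Sigma>}"
  have en: "\<exists>n. en n = \<phi>" if "preds \<phi> \<subseteq> \<Sigma>" for \<phi>
    using from_nat_into_surj[OF countable_fm[OF \<Sigma>], of \<phi>] that by (auto simp: en_def)
  have fin: "finite (\<Union> (fv ` \<Gamma>))" using \<Gamma> by (auto simp: sentence_def)
  define \<Delta> where "\<Delta> = (\<Union>n. henkin en \<Gamma> n)"
  have con\<Delta>: "\<not> \<Delta> \<turnstile> Bot" unfolding \<Delta>_def using fin con by (rule consistent_henkin_union)
  have sub: "henkin en \<Gamma> n \<subseteq> \<Delta>" for n by (auto simp: \<Delta>_def)
  have accept: "insert \<phi> (witness \<phi> (henkin en \<Gamma> n)) \<subseteq> \<Delta>"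
    if "en n = \<phi>" "\<not> insert \<phi> (henkin en \<Gamma> n) \<turnstile> Bot" for n \<phi>
    using sub[of "Suc n"] that by auto
  \<comment> \<open>A formula rejected at its stage is refuted by that stage; any other formula was
    put in.\<close>
  have complete: "\<Delta> \<turnstile> \<phi> \<or> \<Delta> \<turnstile> Neg \<phi>" if "preds \<phi> \<subseteq> \<Sigma>" for \<phi>
  proof -
    obtain n where n: "en n = \<phi>" using en \<open>preds \<phi> \<subseteq> \<Sigma>\<close> by blast
    show ?thesis
    proof (cases "insert \<phi> (henkin en \<Gamma> n) \<turnstile> Bot")
      case True
      then show ?thesis using weakening[OF ImpI sub] by blast
    next
      case False
      then show ?thesis using accept[OF n] Assm[of \<phi> \<Delta>] by blast
    qed
  qed
  have Neg_iff: "\<Delta> \<turnstile> Neg \<phi> \<longleftrightarrow> \<not> \<Delta> \<turnstile> \<phi>" if "preds \<phi> \<subseteq> \<Sigma>" for \<phi>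
    using complete[OF that] con\<Delta> ImpE[of \<Delta> \<phi> Bot] by blast
  have Imp_iff: "\<Delta> \<turnstile> Imp \<phi> \<psi> \<longleftrightarrow> (\<Delta> \<turnstile> \<phi> \<longrightarrow> \<Delta> \<turnstile> \<psi>)" if "preds \<phi> \<subseteq> \<Sigma>" for \<phi> \<psi>
  proof
    assume "\<Delta> \<turnstile> Imp \<phi> \<psi>" then show "\<Delta> \<turnstile> \<phi> \<longrightarrow> \<Delta> \<turnstile> \<psi>" using ImpE[of \<Delta> \<phi> \<psi>] by blast
  next
    assume *: "\<Delta> \<turnstile> \<phi> \<longrightarrow> \<Delta> \<turnstile> \<psi>"
    show "\<Delta> \<turnstile> Imp \<phi> \<psi>"
    proof (cases "\<Delta> \<turnstile> \<phi>")
      case True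
      with * show ?thesis using weakening[of \<Delta> \<psi>] by (intro ImpI) auto
    next
      case False
      then have "insert \<phi> \<Delta> \<turnstile> Neg \<phi>" using Neg_iff[OF that] weakening[of \<Delta> "Neg \<phi>"] by auto
      then have "insert \<phi> \<Delta> \<turnstile> Bot" by (rule ImpE) (auto intro: Assm)
      then show ?thesis by (rule ImpI[OF explosion])
    qed
  qed
  have All_iff: "\<Delta> \<turnstile> All \<phi> \<longleftrightarrow> (\<forall>x. \<Delta> \<turnstile> inst x \<phi>)" if pr: "preds \<phi> \<subseteq> \<Sigma>" for \<phi>
  proof
    assume "\<Delta> \<turnstile> All \<phi>" then show "\<forall>x. \<Delta> \<turnstile> inst x \<phi>" using AllE[of \<Delta> \<phi>] by blast
  next
    assume inst: "\<forall>x. \<Delta> \<turnstile> inst x \<phi>"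
    show "\<Delta> \<turnstile> All \<phi>"
    proof (rule ccontr)
      assume "\<not> \<Delta> \<turnstile> All \<phi>"
      then have neg: "\<Delta> \<turnstile> Neg (All \<phi>)" using Neg_iff pr by simp
      obtain n where n: "en n = Neg (All \<phi>)" using en[of "Neg (All \<phi>)"] pr by auto
      \<comment> \<open>As \<Delta> derives \<open>Neg (All \<phi>)\<close>, this formula cannot
        have been rejected at its stage, so a counterexample variable entered together with
        it.\<close>
      have "\<not> insert (Neg (All \<phi>)) (henkin en \<Gamma> n) \<turnstile> Bot"
      proof
        assume "insert (Neg (All \<phi>)) (henkin en \<Gamma> n) \<turnstile> Bot"
        then have "\<Delta> \<turnstile> Neg (Neg (All \<phi>))" using weakening[OF ImpI sub] by blast
        with neg con\<Delta> show False using ImpE[of \<Delta> "Neg (All \<phi>)" Bot] by blast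
      qed
      from accept[OF n this] obtain x where "Neg (inst x \<phi>) \<in> \<Delta>"
        unfolding witness_def by auto
      then have "\<Delta> \<turnstile> Neg (inst x \<phi>)" by (rule Assm)
      with inst con\<Delta> show False using ImpE[of \<Delta> "inst x \<phi>" Bot] by blast
    qed
  qed
  \<comment> \<open>The least provably equal variable represents its class, which keeps the universe
    inside the natural numbers instead of a quotient.\<close>
  define rep where "rep x = (LEAST y. \<Delta> \<turnstile> Eq x y)" for x
  have Eq_rep: "\<Delta> \<turnstile> Eq x (rep x)" for x
    unfolding rep_def by (rule LeastI[of _ x]) (rule EqRefl)
  have rep_iff: "rep x = rep y \<longleftrightarrow> \<Delta> \<turnstile> Eq x y" for x y
  proof
    assume "rep x = rep y"
    then show "\<Delta> \<turnstile> Eq x y" using Eq_rep[of x] Eq_rep[of y] Eq_sym Eq_trans by metis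
  next
    assume "\<Delta> \<turnstile> Eq x y"
    then have "\<Delta> \<turnstile> Eq x z \<longleftrightarrow> \<Delta> \<turnstile> Eq y z" for z using Eq_sym Eq_trans by metis
    then show "rep x = rep y" by (simp add: rep_def)
  qed
  define M :: "('p, nat) struct" where
    "M = \<lparr>univ = range rep, lt = {(rep x, rep y) |x y. \<Delta> \<turnstile> Less x y},
      prd = (\<lambda>Q. if Q \<in> \<Sigma> then Some {rep x |x. \<Delta> \<turnstile> Pred Q x} else None)\<rparr>"
  \<comment> \<open>The truth lemma is stated for every variable map \<open>f\<close>, since the
    quantifier case moves from \<open>f\<close> to \<open>case_nat x f\<close>.\<close>
  have truth: "sat M (rep \<circ> f) \<phi> \<longleftrightarrow> \<Delta> \<turnstile> ren f \<phi>" if "preds \<phi> \<subseteq> \<Sigma>" for \<phi> f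
    using that
  proof (induction \<phi> arbitrary: f)
    case Bot
    then show ?case using con\<Delta> by simp
  next
    case (Eq x y)
    then show ?case by (simp add: rep_iff)
  next
    case (Less x y)
    show ?case by (simp add: M_def rep_iff) (metis Less_subst Eq_sym EqRefl)
  next
    case (Pred Q x)
    with Pred show ?case by (simp add: M_def rep_iff) (metis Pred_subst Eq_sym EqRefl)
  next
    case (Imp \<phi> \<psi>)
    then show ?case by (simp add: Imp_iff)
  next
    case (All \<phi>)
    have "case_nat (rep x) (rep \<circ> f) = rep \<circ> case_nat x f" for x by (auto split: nat.split)
    then have "sat M (rep \<circ> f) (All \<phi>) \<longleftrightarrow> (\<forall>x. sat M (rep \<circ> case_nat x f) \<phi>)"
      by (simp add: M_def)
    also have "\<dots> \<longleftrightarrow> (\<forall>x. \<Delta> \<turnstile> ren (case_nat x f) \<phi>)" using All.prems by (simp only: All.IH preds.simps)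
    also have "\<dots> \<longleftrightarrow> \<Delta> \<turnstile> ren f (All \<phi>)" using All by (simp add: All_iff inst_ren)
    finally show ?case .
  qed
  have "is_model \<Sigma> M \<Gamma>"
    unfolding is_model_def
  proof (intro conjI ballI allI impI)
    show "is_struct \<Sigma> M"
      by (auto simp: is_struct_def M_def dom_def ran_def split: if_splits)
    fix \<phi> and e :: "nat \<Rightarrow> nat" assume \<phi>: "\<phi> \<in> \<Gamma>" and e: "range e \<subseteq> univ M"
    from \<phi> \<Gamma> have "preds \<phi> \<subseteq> \<Sigma>" "fv \<phi> = {}" by (auto simp: sentence_def)
    moreover have "\<phi> \<in> \<Delta>" using \<phi> sub[of 0] by auto
    ultimately have "sat M (rep \<circ> (\<lambda>x. x)) \<phi>" using truth[of \<phi> "\<lambda>x. x"] Assm[of \<phi> \<Delta>] by simp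
    then show "sat M e \<phi>" using \<open>fv \<phi> = {}\<close> sat_cong[of \<phi> e] by blast
  qed
  then show ?thesis ..
qed

text \<open>Because the signature is countable, structures on \<open>nat\<close> suffice; all later
  provability claims are therefore checked on such structures.\<close>

theorem completeness:
  fixes \<Gamma> :: "'p fm set"
  assumes "countable \<Sigma>" "\<And>\<psi>. \<psi> \<in> \<Gamma> \<Longrightarrow> sentence \<Sigma> \<psi>" "sentence \<Sigma> \<phi>"
    and "\<And>M :: ('p, nat) struct. is_model \<Sigma> M \<Gamma> \<Longrightarrow> is_model \<Sigma> M {\<phi>}"
  shows "\<Gamma> \<turnstile> \<phi>"
proof (rule Contr, rule ccontr)
  assume "\<not> insert (Neg \<phi>) \<Gamma> \<turnstile> Bot"
  moreover have "sentence \<Sigma> \<psi>" if "\<psi> \<in> insert (Neg \<phi>) \<Gamma>" for \<psi>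
    using that assms(2,3) by (auto simp: sentence_def)
  ultimately obtain M :: "('p, nat) struct" where M: "is_model \<Sigma> M (insert (Neg \<phi>) \<Gamma>)"
    using model_existence[OF assms(1)] by metis
  then obtain a where "a \<in> univ M" by (auto simp: is_model_def is_struct_def)
  then have "range (\<lambda>_::nat. a) \<subseteq> univ M" by auto
  moreover have "is_model \<Sigma> M {\<phi>}" using M by (intro assms(4)) (auto simp: is_model_def)
  ultimately show False using M by (fastforce simp: is_model_def)
qed


section \<open>Finite conjunctions, cardinality and relativization\<close>

lemma sat_Conj [simp]: "sat M e (Conj \<phi>s) \<longleftrightarrow> (\<forall>\<phi>\<in>set \<phi>s. sat M e \<phi>)"
  by (induction \<phi>s) auto

lemma fv_Conj [simp]: "fv (Conj \<phi>s) = (\<Union>\<phi>\<in>set \<phi>s. fv \<phi>)"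
  by (induction \<phi>s) auto

lemma preds_Conj [simp]: "preds (Conj \<phi>s) = (\<Union>\<phi>\<in>set \<phi>s. preds \<phi>)"
  by (induction \<phi>s) auto

lemma sat_Ex_funpow:
  "sat M e ((Ex ^^ n) \<phi>) \<longleftrightarrow>
    (\<exists>xs. length xs = n \<and> set xs \<subseteq> univ M \<and>
      sat M (\<lambda>i. if i < n then xs ! i else e (i - n)) \<phi>)"
proof (induction n arbitrary: e)
  case 0
  then show ?case by simp
next
  case (Suc n)
  \<comment> \<open>The outermost quantifier binds the highest index, so its value \<open>a\<close>
    goes to the end of the list.\<close>
  have shift: "(\<lambda>i. if i < n then xs ! i else case_nat a e (i - n)) =
      (\<lambda>i. if i < Suc n then (xs @ [a]) ! i else e (i - Suc n))" if "length xs = n" for xs a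
    using that by (auto simp: fun_eq_iff nth_append split: nat.split intro!: arg_cong[of _ _ e])
  have "sat M e ((Ex ^^ Suc n) \<phi>) \<longleftrightarrow> (\<exists>a\<in>univ M. \<exists>xs. length xs = n \<and> set xs \<subseteq> univ M \<and>
      sat M (\<lambda>i. if i < n then xs ! i else case_nat a e (i - n)) \<phi>)"
    by (simp add: Suc) (simp only: conj_left_commute)
  also have "\<dots> \<longleftrightarrow> (\<exists>a\<in>univ M. \<exists>xs. length xs = n \<and> set xs \<subseteq> univ M \<and>
      sat M (\<lambda>i. if i < Suc n then (xs @ [a]) ! i else e (i - Suc n)) \<phi>)"
    by (intro bex_cong ex_cong1 conj_cong refl) (simp only: shift)
  also have "\<dots> \<longleftrightarrow> (\<exists>ys. length ys = Suc n \<and> set ys \<subseteq> univ M \<and>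
      sat M (\<lambda>i. if i < Suc n then ys ! i else e (i - Suc n)) \<phi>)" (is "?L \<longleftrightarrow> ?R")
  proof
    assume ?L
    then obtain a xs where "a \<in> univ M" "length xs = n" "set xs \<subseteq> univ M"
      "sat M (\<lambda>i. if i < Suc n then (xs @ [a]) ! i else e (i - Suc n)) \<phi>" by blast
    then show ?R by (intro exI[of _ "xs @ [a]"] conjI) simp_all
  next
    assume ?R
    then obtain ys where ys: "length ys = Suc n" "set ys \<subseteq> univ M"
      "sat M (\<lambda>i. if i < Suc n then ys ! i else e (i - Suc n)) \<phi>" by blast
    then obtain xs a where snoc: "ys = xs @ [a]" by (metis length_Suc_conv_rev)
    show ?L using ys[unfolded snoc] by (intro bexI[of _ a] exI[of _ xs] conjI) simp_all
  qed
  finally show ?case .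
qed

lemma sat_at_least:
  "sat M e (at_least n) \<longleftrightarrow> (\<exists>X \<subseteq> univ M. finite X \<and> card X = n)"
proof -
  let ?\<delta> = "Conj [Neg (Eq (n - Suc i) (n - Suc j)). j \<leftarrow> [0..<n], i \<leftarrow> [0..<j]] :: 'a fm"
  have "sat M (\<lambda>i. if i < n then xs ! i else e (i - n)) ?\<delta> \<longleftrightarrow> distinct xs"
    if len: "length xs = n" for xs
  proof -
    \<comment> \<open>The variable numbered \<open>i\<close> has index \<open>n - Suc i\<close>,
      hence the list is read backwards.\<close>
    have "sat M (\<lambda>i. if i < n then xs ! i else e (i - n)) ?\<delta> \<longleftrightarrow>
        (\<forall>j<n. \<forall>i<j. rev xs ! i \<noteq> rev xs ! j)"
      using len by (auto simp: rev_nth)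
    also have "\<dots> \<longleftrightarrow> distinct (rev xs)"
      using len by (auto simp: distinct_conv_nth) (metis linorder_neqE_nat)
    finally show ?thesis by simp
  qed
  then have "sat M e (at_least n) \<longleftrightarrow>
      (\<exists>xs. length xs = n \<and> set xs \<subseteq> univ M \<and> distinct xs)"
    unfolding at_least_def sat_Ex_funpow by blast
  also have "\<dots> \<longleftrightarrow> (\<exists>X \<subseteq> univ M. finite X \<and> card X = n)"
    by (metis List.finite_set distinct_card finite_distinct_list)
  finally show ?thesis .
qed

lemma sat_INF_iff: "(\<forall>\<phi>\<in>INF_ax. sat M e \<phi>) \<longleftrightarrow> infinite (univ M)"
proof
  assume INF: "\<forall>\<phi>\<in>INF_ax. sat M e \<phi>"
  show "infinite (univ M)"
  proof
    assume "finite (univ M)"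
    moreover have "sat M e (at_least (Suc (card (univ M))))" using INF by (simp add: INF_ax_def)
    ultimately show False by (metis Suc_n_not_le_n card_mono sat_at_least)
  qed
next
  assume "infinite (univ M)"
  then have "\<exists>X \<subseteq> univ M. finite X \<and> card X = n" for n
    using infinite_arbitrarily_large[of "univ M" n] by blast
  then show "\<forall>\<phi>\<in>INF_ax. sat M e \<phi>" by (simp add: INF_ax_def sat_at_least)
qed

text \<open>Relativization to the closed initial segment up to \<open>x\<close>; including
  \<open>x\<close> keeps the segment of a point non-empty. Under a binder the bound becomes
  \<open>Suc x\<close>.\<close>

primrec relle :: "nat \<Rightarrow> 'p fm \<Rightarrow> 'p fm" where
  "relle x Bot = Bot"
| "relle x (Eq y z) = Eq y z"
| "relle x (Less y z) = Less y z"
| "relle x (Pred Q y) = Pred Q y"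
| "relle x (Imp \<phi> \<psi>) = Imp (relle x \<phi>) (relle x \<psi>)"
| "relle x (All \<phi>) = All (Imp (Or (Less 0 (Suc x)) (Eq 0 (Suc x))) (relle (Suc x) \<phi>))"

lemma preds_relle [simp]: "preds (relle x \<phi>) = preds \<phi>"
  by (induction \<phi> arbitrary: x) auto

lemma fv_relle: "fv (relle x \<phi>) \<subseteq> insert x (fv \<phi>)"
proof (induction \<phi> arbitrary: x)
  case (Imp \<phi> \<psi>)
  from Imp.IH[of x] show ?case by auto
next
  case (All \<phi>)
  from All.IH[of "Suc x"] show ?case by auto
qed auto

definition below :: "('m \<times> 'm) set \<Rightarrow> 'm set \<Rightarrow> 'm \<Rightarrow> 'm set" where
  "below r X v = {a \<in> X. (a, v) \<in> r \<or> a = v}"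

text \<open>Only \<open>univ\<close> shrinks, while \<open>lt\<close> and \<open>prd\<close> keep
  their values at removed points; a sentence never consults these points.\<close>

lemma sat_relle:
  "sat M e (relle x \<phi>) \<longleftrightarrow> sat (M\<lparr>univ := below (lt M) (univ M) (e x)\<rparr>) e \<phi>"
proof (induction \<phi> arbitrary: x e)
  case (All \<phi>)
  show ?case by (simp add: All.IH) (auto simp: below_def)
qed simp_all


section \<open>Back-and-forth equivalence\<close>

text \<open>The clause on equality makes \<open>R\<close> the graph of an injective partial map, so
  this is partial isomorphism. With a relation in place of two tuples, order and repetition of moves
  disappear.\<close>

definition atoms_agree ::
    "'p set \<Rightarrow> ('p, 'm) struct \<Rightarrow> ('p, 'n) struct \<Rightarrow> ('m \<times> 'n) set \<Rightarrow> bool" where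
  "atoms_agree \<Theta> M N R \<longleftrightarrow> (\<forall>(a, b)\<in>R.
    (\<forall>(a', b')\<in>R. (a = a' \<longleftrightarrow> b = b') \<and> ((a, a') \<in> lt M \<longleftrightarrow> (b, b') \<in> lt N)) \<and>
    (\<forall>Q\<in>\<Theta>. a \<in> the (prd M Q) \<longleftrightarrow> b \<in> the (prd N Q)))"

text \<open>The Ehrenfeucht-Fraisse game: a winning strategy for the duplicator with
  \<open>n\<close> rounds left in position \<open>R\<close>.\<close>

primrec back_forth ::
    "'p set \<Rightarrow> ('p, 'm) struct \<Rightarrow> ('p, 'n) struct \<Rightarrow> nat \<Rightarrow> ('m \<times> 'n) set \<Rightarrow> bool" where
  "back_forth \<Theta> M N 0 R \<longleftrightarrow> atoms_agree \<Theta> M N R"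
| "back_forth \<Theta> M N (Suc n) R \<longleftrightarrow> atoms_agree \<Theta> M N R \<and>
    (\<forall>a\<in>univ M. \<exists>b\<in>univ N. back_forth \<Theta> M N n (insert (a, b) R)) \<and>
    (\<forall>b\<in>univ N. \<exists>a\<in>univ M. back_forth \<Theta> M N n (insert (a, b) R))"

lemma back_forth_atoms: "back_forth \<Theta> M N n R \<Longrightarrow> atoms_agree \<Theta> M N R"
  by (cases n) auto

lemma atoms_agree_subset: "atoms_agree \<Theta> M N R \<Longrightarrow> S \<subseteq> R \<Longrightarrow> atoms_agree \<Theta> M N S"
  unfolding atoms_agree_def split_beta by (simp add: subset_eq Ball_def del: split_paired_All)

lemma back_forth_subset: "back_forth \<Theta> M N n R \<Longrightarrow> S \<subseteq> R \<Longrightarrow> back_forth \<Theta> M N n S"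
proof (induction n arbitrary: R S)
  case 0
  then show ?case unfolding back_forth.simps by (rule atoms_agree_subset)
next
  case (Suc n)
  have "atoms_agree \<Theta> M N S"
    by (rule atoms_agree_subset[OF back_forth_atoms[OF Suc.prems(1)] Suc.prems(2)])
  moreover have "back_forth \<Theta> M N n (insert x S)" if "back_forth \<Theta> M N n (insert x R)" for x
    by (rule Suc.IH[OF that]) (use Suc.prems(2) in auto)
  ultimately show ?case using Suc.prems(1) unfolding back_forth.simps by blast
qed

lemma back_forth_Suc: "back_forth \<Theta> M N (Suc n) R \<Longrightarrow> back_forth \<Theta> M N n R"
proof (induction n arbitrary: R)
  case (Suc n)
  from Suc.prems show ?case
    unfolding back_forth.simps(2)[of \<Theta> M N "Suc n" R] back_forth.simps(2)[of \<Theta> M N n R]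
    using Suc.IH by blast
qed simp

text \<open>The seed for adding top points: nothing lies below the least point of an order.\<close>

lemma back_forth_empty: "univ M = {} \<Longrightarrow> univ N = {} \<Longrightarrow> back_forth \<Theta> M N n {}"
  by (cases n) (auto simp: atoms_agree_def)

section \<open>Equivalence is preserved when a top point is added on both sides\<close>

definition add_top :: "('p, 'm) struct \<Rightarrow> 'm \<Rightarrow> ('p, 'm) struct \<Rightarrow> bool" where
  "add_top M p M' \<longleftrightarrow> univ M' = insert p (univ M) \<and> p \<notin> univ M \<and> (p, p) \<notin> lt M' \<and>
    (\<forall>a\<in>univ M. (a, p) \<in> lt M' \<and> (p, a) \<notin> lt M' \<and>
      (\<forall>b\<in>univ M. (a, b) \<in> lt M' \<longleftrightarrow> (a, b) \<in> lt M) \<and>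
      (\<forall>Q. a \<in> the (prd M' Q) \<longleftrightarrow> a \<in> the (prd M Q)))"

lemma atoms_agree_add_top:
  assumes "atoms_agree \<Theta> M N R" "R \<subseteq> univ M \<times> univ N" "add_top M p M'" "add_top N q N'"
    and "\<And>Q. Q \<in> \<Theta> \<Longrightarrow> p \<in> the (prd M' Q) \<longleftrightarrow> q \<in> the (prd N' Q)"
  shows "atoms_agree \<Theta> M' N' (insert (p, q) R)"
proof -
  have R: "a \<in> univ M" "b \<in> univ N" if "(a, b) \<in> R" for a b using that assms(2) by auto
  have M: "a \<noteq> p" "p \<noteq> a" "(a, p) \<in> lt M'" "(p, a) \<notin> lt M'" "a \<in> the (prd M' Q) \<longleftrightarrow> a \<in> the (prd M Q)"
    if "a \<in> univ M" for a Q
    using that assms(3) by (auto simp: add_top_def)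
  have M2: "(a, b) \<in> lt M' \<longleftrightarrow> (a, b) \<in> lt M" if "a \<in> univ M" "b \<in> univ M" for a b
    using that assms(3) by (auto simp: add_top_def)
  have N: "a \<noteq> q" "q \<noteq> a" "(a, q) \<in> lt N'" "(q, a) \<notin> lt N'" "a \<in> the (prd N' Q) \<longleftrightarrow> a \<in> the (prd N Q)"
    if "a \<in> univ N" for a Q
    using that assms(4) by (auto simp: add_top_def)
  have N2: "(a, b) \<in> lt N' \<longleftrightarrow> (a, b) \<in> lt N" if "a \<in> univ N" "b \<in> univ N" for a b
    using that assms(4) by (auto simp: add_top_def)
  have pq: "(p, p) \<notin> lt M'" "(q, q) \<notin> lt N'" using assms(3,4) by (auto simp: add_top_def)
  have A: "(a = a' \<longleftrightarrow> b = b') \<and> ((a, a') \<in> lt M \<longleftrightarrow> (b, b') \<in> lt N)"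
    if "(a, b) \<in> R" "(a', b') \<in> R" for a b a' b'
    using that assms(1) unfolding atoms_agree_def by fast
  have B: "a \<in> the (prd M Q) \<longleftrightarrow> b \<in> the (prd N Q)" if "(a, b) \<in> R" "Q \<in> \<Theta>" for a b Q
    using that assms(1) unfolding atoms_agree_def by fast
  show ?thesis
    unfolding atoms_agree_def
  proof (clarify, intro conjI ballI)
    fix a b Q assume "(a, b) \<in> insert (p, q) R" "Q \<in> \<Theta>"
    then show "a \<in> the (prd M' Q) \<longleftrightarrow> b \<in> the (prd N' Q)"
      using assms(5) B[of a b Q] M(5) N(5) R[of a b] by auto
  next
    fix a b y assume ab: "(a, b) \<in> insert (p, q) R" and y: "y \<in> insert (p, q) R"
    obtain a' b' where "y = (a', b')" by (cases y)
    with ab y show "case y of (a', b') \<Rightarrow>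
        (a = a' \<longleftrightarrow> b = b') \<and> ((a, a') \<in> lt M' \<longleftrightarrow> (b, b') \<in> lt N')"
      using M N pq A[of a b a' b'] R[of a b] R[of a' b'] by (auto simp: M2 N2)
  qed
qed

text \<open>The duplicator answers one top point by the other and follows the old strategy
  everywhere else.\<close>

lemma back_forth_add_top:
  assumes "back_forth \<Theta> M N n R" "R \<subseteq> univ M \<times> univ N" "add_top M p M'" "add_top N q N'"
    and "\<And>Q. Q \<in> \<Theta> \<Longrightarrow> p \<in> the (prd M' Q) \<longleftrightarrow> q \<in> the (prd N' Q)"
  shows "back_forth \<Theta> M' N' n (insert (p, q) R)"
  using assms(1,2)
proof (induction n arbitrary: R)
  case 0
  then show ?case using atoms_agree_add_top assms(3-5) by fastforce
next
  case (Suc n)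
  have univ: "univ M' = insert p (univ M)" "univ N' = insert q (univ N)"
    using assms(3,4) by (auto simp: add_top_def)
  have atoms: "atoms_agree \<Theta> M' N' (insert (p, q) R)"
    by (rule atoms_agree_add_top[OF back_forth_atoms[OF Suc.prems(1)] Suc.prems(2) assms(3,4)])
      (rule assms(5))
  \<comment> \<open>A move to a top point leaves the position unchanged and merely spends a
    round.\<close>
  have new: "back_forth \<Theta> M' N' n (insert (p, q) (insert (p, q) R))"
    using Suc.IH[OF back_forth_Suc[OF Suc.prems(1)] Suc.prems(2)] by simp
  have old: "back_forth \<Theta> M' N' n (insert (a, b) (insert (p, q) R))"
    if "a \<in> univ M" "b \<in> univ N" "back_forth \<Theta> M N n (insert (a, b) R)" for a b
    using Suc.IH[OF that(3)] that(1,2) Suc.prems(2) by (simp add: insert_commute)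
  have "\<exists>b\<in>univ N'. back_forth \<Theta> M' N' n (insert (a, b) (insert (p, q) R))"
    if "a \<in> univ M'" for a
    using that Suc.prems(1) new old unfolding univ back_forth.simps by blast
  moreover have "\<exists>a\<in>univ M'. back_forth \<Theta> M' N' n (insert (a, b) (insert (p, q) R))"
    if "b \<in> univ N'" for b
    using that Suc.prems(1) new old unfolding univ back_forth.simps by blast
  ultimately show ?case using atoms by simp
qed

section \<open>Quantifier rank and definability of the equivalence classes\<close>

primrec qr :: "'p fm \<Rightarrow> nat" where
  "qr Bot = 0"
| "qr (Eq x y) = 0"
| "qr (Less x y) = 0"
| "qr (Pred Q x) = 0"
| "qr (Imp \<phi> \<psi>) = max (qr \<phi>) (qr \<psi>)"
| "qr (All \<phi>) = Suc (qr \<phi>)"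

lemma qr_Conj: "qr (Conj \<phi>s) \<le> n \<longleftrightarrow> (\<forall>\<phi>\<in>set \<phi>s. qr \<phi> \<le> n)"
  by (induction \<phi>s) auto

text \<open>Each quantifier is paid for by one round of the game. Extra pairs in \<open>R\<close>
  are allowed, so the position survives the passage to subformulas.\<close>

lemma back_forth_sat:
  assumes "back_forth \<Theta> M N n R" "qr \<phi> \<le> n" "preds \<phi> \<subseteq> \<Theta>" "\<And>x. x \<in> fv \<phi> \<Longrightarrow> (e x, f x) \<in> R"
  shows "sat M e \<phi> \<longleftrightarrow> sat N f \<phi>"
  using assms
proof (induction \<phi> arbitrary: n R e f)
  case (Eq x y)
  then have "(e x, f x) \<in> R" "(e y, f y) \<in> R" by auto
  with back_forth_atoms[OF Eq.prems(1)] show ?case unfolding atoms_agree_def by fastforce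
next
  case (Less x y)
  then have "(e x, f x) \<in> R" "(e y, f y) \<in> R" by auto
  with back_forth_atoms[OF Less.prems(1)] show ?case unfolding atoms_agree_def by fastforce
next
  case (Pred Q x)
  then have "(e x, f x) \<in> R" "Q \<in> \<Theta>" by auto
  with back_forth_atoms[OF Pred.prems(1)] show ?case unfolding atoms_agree_def by fastforce
next
  case (Imp \<phi> \<psi>)
  have "sat M e \<phi> \<longleftrightarrow> sat N f \<phi>"
    using Imp.prems by (intro Imp.IH(1)[of n R]) auto
  moreover have "sat M e \<psi> \<longleftrightarrow> sat N f \<psi>"
    using Imp.prems by (intro Imp.IH(2)[of n R]) auto
  ultimately show ?case by simp
next
  case (All \<phi>)
  then obtain m where n: "n = Suc m" by (cases n) auto
  have step: "sat M (case_nat a e) \<phi> \<longleftrightarrow> sat N (case_nat b f) \<phi>"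
    if "back_forth \<Theta> M N m (insert (a, b) R)" for a b
    using All.prems n by (intro All.IH[OF that]) (auto split: nat.split)
  show ?case using All.prems(1) step unfolding n by (simp) blast
qed simp

text \<open>The conjunction of this list is a complete description: it fixes the truth value of
  every listed formula, positive exactly on \<open>S\<close>.\<close>

definition literals :: "'p fm set \<Rightarrow> 'p fm list \<Rightarrow> 'p fm list" where
  "literals S = map (\<lambda>\<phi>. if \<phi> \<in> S then \<phi> else Neg \<phi>)"

lemma sat_literals:
  "(\<forall>\<phi>\<in>set (literals S \<phi>s). sat M e \<phi>) \<longleftrightarrow> {\<phi> \<in> set \<phi>s. sat M e \<phi>} = S \<inter> set \<phi>s"
proof -
  have "sat M e (if \<phi> \<in> S then \<phi> else Neg \<phi>) \<longleftrightarrow> (sat M e \<phi> \<longleftrightarrow> \<phi> \<in> S)" for \<phi> by simp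
  then have "(\<forall>\<phi>\<in>set (literals S \<phi>s). sat M e \<phi>) \<longleftrightarrow> (\<forall>\<phi>\<in>set \<phi>s. sat M e \<phi> \<longleftrightarrow> \<phi> \<in> S)"
    by (simp only: literals_def set_map ball_simps)
  also have "\<dots> \<longleftrightarrow> (\<forall>\<phi>. \<phi> \<in> set \<phi>s \<and> sat M e \<phi> \<longleftrightarrow> \<phi> \<in> S \<and> \<phi> \<in> set \<phi>s)" by blast
  finally show ?thesis by (simp only: set_eq_iff mem_Collect_eq Int_iff)
qed

definition atom_list :: "'p list \<Rightarrow> nat \<Rightarrow> 'p fm list" where
  "atom_list Ps k = [Eq i j. i \<leftarrow> [0..<k], j \<leftarrow> [0..<k]] @
    [Less i j. i \<leftarrow> [0..<k], j \<leftarrow> [0..<k]] @ [Pred Q i. Q \<leftarrow> Ps, i \<leftarrow> [0..<k]]"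

text \<open>
  The truth values of the finitely many formulas in \<open>basis Ps n k\<close> determine the rank-\<open>n\<close> type
  of the variables below \<open>k\<close>, which makes back-and-forth classes definable.
\<close>

primrec basis :: "'p list \<Rightarrow> nat \<Rightarrow> nat \<Rightarrow> 'p fm list" where
  "basis Ps 0 k = atom_list Ps k"
| "basis Ps (Suc n) k = atom_list Ps k @
    map (\<lambda>\<phi>s. Ex (Conj (literals (set \<phi>s) (basis Ps n (Suc k))))) (subseqs (basis Ps n (Suc k)))"

lemma basis_syntax:
  "\<phi> \<in> set (basis Ps n k) \<Longrightarrow> fv \<phi> \<subseteq> {..<k} \<and> preds \<phi> \<subseteq> set Ps \<and> qr \<phi> \<le> n"
proof (induction n arbitrary: k \<phi>)
  case 0
  then show ?case by (auto simp: atom_list_def)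
next
  case (Suc n)
  have lit: "fv \<psi> \<subseteq> {..<Suc k}" "preds \<psi> \<subseteq> set Ps" "qr \<psi> \<le> n"
    if \<psi>: "\<psi> \<in> set (literals S (basis Ps n (Suc k)))" for \<psi> S
  proof -
    obtain \<chi> where "\<chi> \<in> set (basis Ps n (Suc k))" "\<psi> = \<chi> \<or> \<psi> = Neg \<chi>"
      using \<psi> by (auto simp: literals_def)
    with Suc.IH[of \<chi> "Suc k"] show "fv \<psi> \<subseteq> {..<Suc k}" "preds \<psi> \<subseteq> set Ps" "qr \<psi> \<le> n" by auto
  qed
  have ex: "fv \<phi> \<subseteq> {..<k} \<and> preds \<phi> \<subseteq> set Ps \<and> qr \<phi> \<le> Suc n"
    if \<phi>: "\<phi> = Ex (Conj (literals S (basis Ps n (Suc k))))" for S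
  proof -
    have "fv (Conj (literals S (basis Ps n (Suc k)))) \<subseteq> {..<Suc k}"
      unfolding fv_Conj using lit(1)[of _ S] by blast
    then have "fv \<phi> \<subseteq> {..<k}" unfolding \<phi> by (auto simp del: fv_Conj)
    moreover have "preds (Conj (literals S (basis Ps n (Suc k)))) \<subseteq> set Ps"
      unfolding preds_Conj using lit(2)[of _ S] by blast
    moreover have "qr (Conj (literals S (basis Ps n (Suc k)))) \<le> n"
      unfolding qr_Conj using lit(3)[of _ S] by blast
    ultimately show ?thesis unfolding \<phi> by simp
  qed
  moreover have "fv \<phi> \<subseteq> {..<k} \<and> preds \<phi> \<subseteq> set Ps \<and> qr \<phi> \<le> Suc n" if "\<phi> \<in> set (atom_list Ps k)"
    using that by (auto simp: atom_list_def)
  moreover have "\<phi> \<in> set (atom_list Ps k) \<or>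
      (\<exists>S. \<phi> = Ex (Conj (literals S (basis Ps n (Suc k)))))"
    using Suc.prems by auto
  ultimately show ?case using ex by blast
qed

lemma atom_list_agree:
  assumes "\<forall>\<phi>\<in>set (atom_list Ps k). sat M e \<phi> \<longleftrightarrow> sat N f \<phi>"
  shows "atoms_agree (set Ps) M N {(e i, f i) |i. i < k}"
proof -
  have "Eq i j \<in> set (atom_list Ps k)" "Less i j \<in> set (atom_list Ps k)" if "i < k" "j < k" for i j
    using that by (auto simp: atom_list_def image_iff)
  with assms have "e i = e j \<longleftrightarrow> f i = f j" "(e i, e j) \<in> lt M \<longleftrightarrow> (f i, f j) \<in> lt N"
    if "i < k" "j < k" for i j
    using that sat.simps(2,3) by metis+
  moreover have "Pred Q i \<in> set (atom_list Ps k)" if "i < k" "Q \<in> set Ps" for i Q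
    using that by (auto simp: atom_list_def image_iff)
  with assms have "e i \<in> the (prd M Q) \<longleftrightarrow> f i \<in> the (prd N Q)"
    if "i < k" "Q \<in> set Ps" for i Q
    using that sat.simps(4) by metis
  ultimately show ?thesis by (auto simp: atoms_agree_def)
qed

text \<open>Agreement on the basis means that the same descriptions of one further point are
  realized on both sides, so every move has an answer with the same description.\<close>

lemma basis_back_forth:
  assumes "\<forall>\<phi>\<in>set (basis Ps n k). sat M e \<phi> \<longleftrightarrow> sat N f \<phi>"
  shows "back_forth (set Ps) M N n {(e i, f i) |i. i < k}"
  using assms
proof (induction n arbitrary: k e f)
  case 0
  then show ?case by (simp add: atom_list_agree)
next
  case (Suc n)
  let ?B = "basis Ps n (Suc k)" and ?R = "{(e i, f i) |i. i < k}"
  have "atoms_agree (set Ps) M N ?R"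
    using Suc.prems by (intro atom_list_agree) simp
  moreover have ext: "back_forth (set Ps) M N n (insert (a, b) ?R)"
    if "{\<phi> \<in> set ?B. sat M (case_nat a e) \<phi>} = {\<phi> \<in> set ?B. sat N (case_nat b f) \<phi>}" for a b
  proof -
    have "back_forth (set Ps) M N n {(case_nat a e i, case_nat b f i) |i. i < Suc k}"
      using that by (intro Suc.IH) blast
    moreover have "{(case_nat a e i, case_nat b f i) |i. i < Suc k} = insert (a, b) ?R"
      by (simp add: setcompr_eq_image lessThan_def[symmetric] lessThan_Suc_eq_insert_0 image_image)
    ultimately show ?thesis by simp
  qed
  \<comment> \<open>For each set \<open>S\<close> of basis formulas of lower rank, one existential
    basis formula says that some point realizes exactly \<open>S\<close>.\<close>
  have real: "(\<exists>a\<in>univ M. {\<phi> \<in> set ?B. sat M (case_nat a e) \<phi>} = S) \<longleftrightarrow>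
      (\<exists>b\<in>univ N. {\<phi> \<in> set ?B. sat N (case_nat b f) \<phi>} = S)" if S: "S \<subseteq> set ?B" for S
  proof -
    have "S \<in> set ` set (subseqs ?B)" using S by (simp add: subseqs_powset)
    then obtain \<phi>s where \<phi>s: "\<phi>s \<in> set (subseqs ?B)" "set \<phi>s = S" by auto
    then have "Ex (Conj (literals S ?B)) \<in> set (basis Ps (Suc n) k)" by auto
    with Suc.prems have "sat M e (Ex (Conj (literals S ?B))) \<longleftrightarrow> sat N f (Ex (Conj (literals S ?B)))"
      by (rule bspec)
    moreover have "S \<inter> set ?B = S" using S by auto
    ultimately show ?thesis by (simp add: sat_literals)
  qed
  have "\<exists>b\<in>univ N. back_forth (set Ps) M N n (insert (a, b) ?R)" if "a \<in> univ M" for a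
    using real[of "{\<phi> \<in> set ?B. sat M (case_nat a e) \<phi>}"] ext[of a] that by blast
  moreover have "\<exists>a\<in>univ M. back_forth (set Ps) M N n (insert (a, b) ?R)" if "b \<in> univ N" for b
    using real[of "{\<phi> \<in> set ?B. sat N (case_nat b f) \<phi>}"] ext[of _ b] that by blast
  ultimately show ?case by simp
qed

lemma basis_iff_back_forth:
  "(\<forall>\<phi>\<in>set (basis Ps n 0). sat M e \<phi> \<longleftrightarrow> sat N f \<phi>) \<longleftrightarrow> back_forth (set Ps) M N n {}"
proof
  assume "\<forall>\<phi>\<in>set (basis Ps n 0). sat M e \<phi> \<longleftrightarrow> sat N f \<phi>"
  from basis_back_forth[OF this] show "back_forth (set Ps) M N n {}" by simp
next
  assume bf: "back_forth (set Ps) M N n {}"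
  show "\<forall>\<phi>\<in>set (basis Ps n 0). sat M e \<phi> \<longleftrightarrow> sat N f \<phi>"
  proof
    fix \<phi> assume "\<phi> \<in> set (basis Ps n 0)"
    then show "sat M e \<phi> \<longleftrightarrow> sat N f \<phi>"
      using basis_syntax[of \<phi> Ps n 0] by (intro back_forth_sat[OF bf]) auto
  qed
qed

text \<open>The family \<open>\<C>\<close> may be infinite, but its members realize only finitely
  many truth patterns on the basis; \<psi> is the disjunction of the complete descriptions of these
  patterns.\<close>

lemma definable_union_of_classes:
  fixes \<C> :: "('p, 'n) struct set"
  obtains \<psi> where "sentence (set Ps) \<psi>"
    "\<And>(M :: ('p, 'm) struct) e. sat M e \<psi> \<longleftrightarrow> (\<exists>N\<in>\<C>. back_forth (set Ps) M N n {})"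
proof -
  let ?B = "basis Ps n 0"
  \<comment> \<open>With \<open>k = 0\<close> the basis consists of closed formulas, so any
    assignment serves.\<close>
  define theo where "theo N = {\<phi> \<in> set ?B. sat N (\<lambda>_. undefined) \<phi>}" for N :: "('p, 'n) struct"
  define \<psi> where "\<psi> = Neg (Conj (map (\<lambda>\<phi>s. Neg (Conj (literals (set \<phi>s) ?B)))
      (filter (\<lambda>\<phi>s. set \<phi>s \<in> theo ` \<C>) (subseqs ?B))))"
  have "sentence (set Ps) \<psi>"
    using basis_syntax[of _ Ps n 0] by (fastforce simp: \<psi>_def sentence_def literals_def)
  moreover have "sat M e \<psi> \<longleftrightarrow> (\<exists>N\<in>\<C>. back_forth (set Ps) M N n {})"
    for M :: "('p, 'm) struct" and e
  proof -
    have sub: "theo ` \<C> \<inter> set ` set (subseqs ?B) = theo ` \<C>"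
      by (auto simp: theo_def subseqs_powset)
    have "sat M e \<psi> \<longleftrightarrow> (\<exists>S\<in>theo ` \<C> \<inter> set ` set (subseqs ?B). {\<phi> \<in> set ?B. sat M e \<phi>} = S \<inter> set ?B)"
      by (auto simp: \<psi>_def sat_literals)
    also have "\<dots> \<longleftrightarrow> (\<exists>N\<in>\<C>. {\<phi> \<in> set ?B. sat M e \<phi>} = theo N \<inter> set ?B)"
      unfolding sub by simp
    also have "\<dots> \<longleftrightarrow> (\<exists>N\<in>\<C>. \<forall>\<phi>\<in>set ?B. sat M e \<phi> \<longleftrightarrow> sat N (\<lambda>_. undefined) \<phi>)"
      by (intro bex_cong) (auto simp: theo_def)
    finally show ?thesis by (simp only: basis_iff_back_forth)
  qed
  ultimately show ?thesis by (rule that)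
qed


section \<open>Translations\<close>

lemma fv_ren_subset: "fv (ren f \<phi>) \<subseteq> f ` fv \<phi>"
proof (induction \<phi> arbitrary: f)
  case (Imp \<phi> \<psi>)
  from Imp.IH[of f] show ?case by auto
next
  case (All \<phi>)
  show ?case
  proof
    fix x assume "x \<in> fv (ren f (All \<phi>))"
    then obtain y where "y \<in> fv \<phi>" "Suc x = case_nat 0 (Suc \<circ> f) y"
      using All.IH[of "case_nat 0 (Suc \<circ> f)"] by auto
    then show "x \<in> f ` fv (All \<phi>)" by (cases y) auto
  qed
qed auto

lemma fv_translate:
  assumes "\<And>Q. Q \<in> preds \<phi> \<Longrightarrow> fv (\<tau> Q) \<subseteq> {0}"
  shows "fv (translate \<tau> \<phi>) \<subseteq> fv \<phi>"
  using assms
proof (induction \<phi>)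
  case (Pred Q x)
  then have "case_nat x (\<lambda>n. n) ` fv (\<tau> Q) \<subseteq> {x}" by force
  then show ?case
    using fv_ren_subset[of "case_nat x (\<lambda>n. n)" "\<tau> Q"] unfolding inst_def translate.simps fv.simps
    by (rule subset_trans[rotated])
qed auto

lemma preds_translate:
  "(\<And>Q. Q \<in> preds \<phi> \<Longrightarrow> preds (\<tau> Q) \<subseteq> \<Sigma>) \<Longrightarrow> preds (translate \<tau> \<phi>) \<subseteq> \<Sigma>"
  by (induction \<phi>) auto

text \<open>Each symbol receives the set its translation defines, not cut down to the universe;
  \<open>sat_UB\<close> performs the cut.\<close>

lemma sat_translate:
  assumes "\<And>Q. Q \<in> preds \<phi> \<Longrightarrow> fv (\<tau> Q) \<subseteq> {0}"
  shows "sat M e (translate \<tau> \<phi>) \<longleftrightarrow> sat (M\<lparr>prd := \<lambda>Q. Some {a. sat M (\<lambda>_. a) (\<tau> Q)}\<rparr>) e \<phi>"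
  using assms
proof (induction \<phi> arbitrary: e)
  case (Pred Q x)
  then have "fv (\<tau> Q) \<subseteq> {0}" by simp
  then have "sat M (case_nat (e x) e) (\<tau> Q) \<longleftrightarrow> sat M (\<lambda>_. e x) (\<tau> Q)"
    by (intro sat_cong) auto
  then show ?case by (simp add: sat_inst)
qed simp_all

lemma sentence_at_least: "sentence \<Sigma> (at_least n)"
proof -
  have fv: "fv ((Ex ^^ n) \<phi>) = {x. x + n \<in> fv \<phi>}" for \<phi> :: "'p fm" and n
    by (induction n) auto
  have preds: "preds ((Ex ^^ n) \<phi>) = preds \<phi>" for \<phi> :: "'p fm" and n
    by (induction n) auto
  show ?thesis unfolding sentence_def at_least_def fv preds by auto
qed


section \<open>Linear orders\<close>

definition lin_ord :: "'m set \<Rightarrow> ('m \<times> 'm) set \<Rightarrow> bool" where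
  "lin_ord X r \<longleftrightarrow> (\<forall>x\<in>X. (x, x) \<notin> r) \<and>
    (\<forall>x\<in>X. \<forall>y\<in>X. \<forall>z\<in>X. (x, y) \<in> r \<and> (y, z) \<in> r \<longrightarrow> (x, z) \<in> r) \<and>
    (\<forall>x\<in>X. \<forall>y\<in>X. (x, y) \<in> r \<or> x = y \<or> (y, x) \<in> r)"

lemma sat_LIN_iff: "(\<forall>\<phi>\<in>LIN_ax. sat M e \<phi>) \<longleftrightarrow> lin_ord (univ M) (lt M)"
  by (simp add: LIN_ax_def lin_ord_def numeral_2_eq_2) (simp only: disj_imp)

definition unbounded :: "'m set \<Rightarrow> ('m \<times> 'm) set \<Rightarrow> bool" where
  "unbounded X r \<longleftrightarrow> X \<noteq> {} \<and>
    ((\<forall>y\<in>X. \<exists>z\<in>X. (y, z) \<in> r) \<or> (\<forall>y\<in>X. \<exists>z\<in>X. (z, y) \<in> r))"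

lemma sat_UB: "sat M e (UB P) \<longleftrightarrow> unbounded (univ M \<inter> the (prd M P)) (lt M)"
  proof -
  let ?X = "univ M \<inter> the (prd M P)"
  have "?X \<noteq> {} \<longleftrightarrow> (\<exists>a\<in>univ M. a \<in> the (prd M P))" by blast
  moreover have "(\<forall>a\<in>?X. \<phi> a) \<longleftrightarrow> (\<forall>a\<in>univ M. a \<in> the (prd M P) \<longrightarrow> \<phi> a)" for \<phi> by blast
  moreover have "(\<exists>a\<in>?X. \<phi> a) \<longleftrightarrow> (\<exists>a\<in>univ M. a \<in> the (prd M P) \<and> \<phi> a)" for \<phi> by blast
  ultimately show ?thesis by (simp add: UB_def unbounded_def)
qed

text \<open>A non-empty finite subset of a linear order has both a maximum and a minimum.\<close>

lemma infinite_unbounded: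
  assumes lin: "lin_ord X r" and "unbounded Y r" "Y \<subseteq> X"
  shows "infinite X"
proof
  assume "finite X"
  then have fin: "finite Y" using \<open>Y \<subseteq> X\<close> finite_subset by blast
  have ne: "Y \<noteq> {}" using assms(2) by (simp add: unbounded_def)
  have X: "x \<in> X" if "x \<in> Y" for x using that \<open>Y \<subseteq> X\<close> by blast
  have irr: "(x, x) \<notin> r" if "x \<in> Y" for x using lin X[OF that] by (simp add: lin_ord_def)
  have tr: "(x, z) \<in> r" if "(x, y) \<in> r" "(y, z) \<in> r" "x \<in> Y" "y \<in> Y" "z \<in> Y" for x y z
    using lin X that unfolding lin_ord_def by blast
  have "asymp_on Y (\<lambda>x y. (x, y) \<in> r)" using irr tr by (intro asymp_onI) blast
  moreover have "transp_on Y (\<lambda>x y. (x, y) \<in> r)" using tr by (intro transp_onI) blast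
  ultimately have
    "\<exists>m\<in>Y. \<forall>x\<in>Y. x \<noteq> m \<longrightarrow> (m, x) \<notin> r" "\<exists>m\<in>Y. \<forall>x\<in>Y. x \<noteq> m \<longrightarrow> (x, m) \<notin> r"
    using Finite_Set.bex_max_element[OF fin _ _ ne] Finite_Set.bex_min_element[OF fin _ _ ne] by blast+
  with assms(2) irr show False unfolding unbounded_def by metis
qed

text \<open>Induction along an order in which only three sets are known to have endpoints. It is
  used with \<open>K\<close> being finiteness and with \<open>K\<close> being equivalence to a
  finite labelled order. The alternative \<open>Y = {}\<close> in the step starts the induction at
  the least point.\<close>

lemma bounded_induct:
  assumes lin: "lin_ord X r" and ne: "X \<noteq> {}"
    and step: "\<And>p Y. p \<in> X \<Longrightarrow> Y \<subseteq> X \<Longrightarrow> (\<And>y. y \<in> Y \<Longrightarrow> (y, p) \<in> r) \<Longrightarrow> Y = {} \<or> K Y \<Longrightarrow>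
      K (insert p Y)"
    and D: "D = {v \<in> X. K (below r X v)}"
    and bdd: "\<not> unbounded X r" "\<not> unbounded D r" "\<not> unbounded {v \<in> X. \<forall>u\<in>D. (u, v) \<in> r} r"
  shows "K X"
proof -
  have irr: "(x, x) \<notin> r" if "x \<in> X" for x using lin that by (simp add: lin_ord_def)
  have tr: "(x, z) \<in> r" if "(x, y) \<in> r" "(y, z) \<in> r" "x \<in> X" "y \<in> X" "z \<in> X" for x y z
    using lin that unfolding lin_ord_def by blast
  have tot: "(x, y) \<in> r \<or> x = y \<or> (y, x) \<in> r" if "x \<in> X" "y \<in> X" for x y
    using lin that unfolding lin_ord_def by blast
  have DX: "D \<subseteq> X" using D by blast
  obtain m where m: "m \<in> X" "\<And>x. x \<in> X \<Longrightarrow> (x, m) \<notin> r"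
    using bdd(1) ne unfolding unbounded_def by blast
  obtain t where t: "t \<in> X" "\<And>x. x \<in> X \<Longrightarrow> (t, x) \<notin> r"
    using bdd(1) ne unfolding unbounded_def by blast
  have "below r X m = insert m {}" using m unfolding below_def by blast
  moreover have "K (insert m {})" using m(1) by (intro step) auto
  ultimately have "m \<in> D" using D m(1) by simp
  then obtain d where d: "d \<in> D" "\<And>x. x \<in> D \<Longrightarrow> (d, x) \<notin> r"
    using bdd(2) unfolding unbounded_def by blast
  have dX: "d \<in> X" using d(1) DX by blast
  \<comment> \<open>Otherwise the set of strict upper bounds of \<open>D\<close> contains
    \<open>t\<close> and so has a least element \<open>p\<close>, the immediate successor of
    \<open>d\<close>; then \<open>p\<close> would belong to \<open>D\<close>.\<close>
  have "\<not> (\<forall>u\<in>D. (u, t) \<in> r)"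
  proof
    assume "\<forall>u\<in>D. (u, t) \<in> r"
    with t(1) have "{v \<in> X. \<forall>u\<in>D. (u, v) \<in> r} \<noteq> {}" by blast
    with bdd(3) obtain p where p: "p \<in> X" "\<And>u. u \<in> D \<Longrightarrow> (u, p) \<in> r"
      and least: "\<And>x. x \<in> X \<Longrightarrow> \<forall>u\<in>D. (u, x) \<in> r \<Longrightarrow> (x, p) \<notin> r"
      unfolding unbounded_def by blast
    have "below r X p = insert p (below r X d)"
    proof (intro set_eqI iffI)
      fix x assume x: "x \<in> below r X p"
      show "x \<in> insert p (below r X d)"
      proof (cases "x = p")
        case False
        with x have "x \<in> X" "(x, p) \<in> r" by (auto simp: below_def)
        \<comment> \<open>A point strictly below \<open>p\<close> is no strict upper bound of
          \<open>D\<close>, so some member of \<open>D\<close>, and hence \<open>d\<close>, is at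
          least as large.\<close>
        with least obtain u where u: "u \<in> D" "(u, x) \<notin> r" by blast
        then have "u \<in> X" using DX by blast
        have "(x, u) \<in> r \<or> x = u" using tot[OF \<open>x \<in> X\<close> \<open>u \<in> X\<close>] u(2) by blast
        moreover have "(u, d) \<in> r \<or> u = d" using tot[OF \<open>u \<in> X\<close> dX] d(2)[OF u(1)] by blast
        ultimately have "(x, d) \<in> r \<or> x = d" using tr \<open>x \<in> X\<close> \<open>u \<in> X\<close> dX by blast
        with \<open>x \<in> X\<close> show ?thesis by (simp add: below_def)
      qed simp
    next
      fix x assume "x \<in> insert p (below r X d)"
      then show "x \<in> below r X p"
        using p(1) p(2)[OF d(1)] tr[of x d p] dX by (auto simp: below_def)
    qed
    moreover have "K (insert p (below r X d))"
    proof (rule step[OF p(1)])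
      show "below r X d \<subseteq> X" by (auto simp: below_def)
      show "(y, p) \<in> r" if "y \<in> below r X d" for y
        using that p(2)[OF d(1)] tr[of y d p] dX p(1) by (auto simp: below_def)
      show "below r X d = {} \<or> K (below r X d)" using d(1) D by simp
    qed
    ultimately have "p \<in> D" using D p(1) by simp
    with p(2) irr p(1) show False by blast
  qed
  \<comment> \<open>Since nothing lies above \<open>t\<close>, this \<open>u\<close> equals
    \<open>t\<close>, and the closed segment of \<open>t\<close> is all of \<open>X\<close>.\<close>
  then obtain u where u: "u \<in> D" "(u, t) \<notin> r" by blast
  with tot[of u t] t DX have "t \<in> D" by blast
  moreover have "below r X t = X" using tot t unfolding below_def by blast
  ultimately show ?thesis using D by simp
qed

text \<open>If every subset had both endpoints, the induction above with \<open>K = finite\<close>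
  would make \<open>X\<close> finite.\<close>

lemma infinite_has_unbounded:
  assumes "lin_ord X r" "infinite X"
  obtains Y where "Y \<subseteq> X" "unbounded Y r"
proof -
  have "\<exists>Y \<subseteq> X. unbounded Y r"
  proof (rule ccontr)
    assume "\<not> (\<exists>Y \<subseteq> X. unbounded Y r)"
    then have none: "\<not> unbounded Y r" if "Y \<subseteq> X" for Y using that by blast
    let ?D = "{v \<in> X. finite (below r X v)}"
    have bdd: "\<not> unbounded X r" "\<not> unbounded ?D r"
      "\<not> unbounded {v \<in> X. \<forall>u\<in>?D. (u, v) \<in> r} r"
      by (intro none; blast)+
    have "X \<noteq> {}" using assms(2) by auto
    then have "finite X"
      by (rule bounded_induct[where K = finite and r = r and X = X, OF assms(1) _ _ refl bdd]) auto
    with assms(2) show False by simp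
  qed
  with that show thesis by blast
qed


section \<open>Definable unbounded sets\<close>

definition defset :: "('p, 'm) struct \<Rightarrow> 'p fm \<Rightarrow> 'm set" where
  "defset M \<delta> = {a \<in> univ M. sat M (\<lambda>_. a) \<delta>}"

text \<open>
  The symbol \<open>P\<close> is immaterial in \<open>select\<close>: the translation replaces it by \<open>\<delta>\<close>.
\<close>

definition select :: "'p \<Rightarrow> 'p fm \<Rightarrow> 'p fm \<Rightarrow> 'p fm" where
  "select P \<delta> \<epsilon> =
    (let \<beta> = translate (\<lambda>_. \<delta>) (UB P) in Or (And \<beta> \<delta>) (And (Neg \<beta>) \<epsilon>))"

lemma sat_translate_UB:
  assumes "fv \<delta> \<subseteq> {0}"
  shows "sat M e (translate (\<lambda>_. \<delta>) (UB P)) \<longleftrightarrow> unbounded (defset M \<delta>) (lt M)"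
proof -
  have "univ M \<inter> {a. sat M (\<lambda>_. a) \<delta>} = defset M \<delta>" by (auto simp: defset_def)
  then show ?thesis using assms by (simp add: sat_translate sat_UB)
qed

lemma select_syntax:
  assumes "fv \<delta> \<subseteq> {0}" "fv \<epsilon> \<subseteq> {0}" "preds \<delta> \<subseteq> \<Sigma>" "preds \<epsilon> \<subseteq> \<Sigma>"
  shows "fv (select P \<delta> \<epsilon>) \<subseteq> {0}" "preds (select P \<delta> \<epsilon>) \<subseteq> \<Sigma>"
proof -
  have "fv (UB P) = {}" by (auto simp: UB_def)
  then have "fv (translate (\<lambda>_. \<delta>) (UB P)) = {}"
    using fv_translate[of "UB P" "\<lambda>_. \<delta>"] assms(1) by blast
  with assms show "fv (select P \<delta> \<epsilon>) \<subseteq> {0}" by (auto simp: select_def Let_def)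
  show "preds (select P \<delta> \<epsilon>) \<subseteq> \<Sigma>"
    using assms preds_translate[of "UB P" "\<lambda>_. \<delta>" \<Sigma>] by (simp add: select_def Let_def)
qed

text \<open>The case distinction is made by a sentence, so in each structure the selected set is
  entirely one of the two candidates.\<close>

lemma unbounded_select:
  assumes "fv \<delta> \<subseteq> {0}" "unbounded (defset M \<delta>) (lt M) \<or> unbounded (defset M \<epsilon>) (lt M)"
  shows "unbounded (defset M (select P \<delta> \<epsilon>)) (lt M)"
proof -
  have "defset M (select P \<delta> \<epsilon>) =
      (if unbounded (defset M \<delta>) (lt M) then defset M \<delta> else defset M \<epsilon>)"
    using assms(1) by (auto simp: select_def Let_def sat_translate_UB defset_def)
  then show ?thesis using assms(2) by auto
qed

text \<open>A finite labelled order. The case \<open>m = 0\<close> is kept as a partner for the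
  empty segment.\<close>

definition word :: "nat \<Rightarrow> ('p \<Rightarrow> nat set) \<Rightarrow> ('p, nat) struct" where
  "word m w = \<lparr>univ = {..<m}, lt = {(i, j). i < j}, prd = (\<lambda>Q. Some (w Q))\<rparr>"

lemma definable_unbounded:
  fixes \<alpha> :: "'p fm"
  assumes "finite \<Theta>" and \<alpha>: "sentence \<Theta> \<alpha>" and LIN: "{\<alpha>} \<tturnstile> LIN_ax" and INF: "{\<alpha>} \<tturnstile> INF_ax"
  obtains \<delta> where "fv \<delta> \<subseteq> {0}" "preds \<delta> \<subseteq> \<Theta>"
    "\<And>M :: ('p, nat) struct. is_model \<Theta> M {\<alpha>} \<Longrightarrow> unbounded (defset M \<delta>) (lt M)"
proof -
  obtain Ps where Ps: "set Ps = \<Theta>" using finite_list[OF assms(1)] by blast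
  \<comment> \<open>This rank is just enough to carry \<alpha> over to a finite word at the
    end.\<close>
  define n where "n = qr \<alpha>"
  \<comment> \<open>Empty words are excluded because soundness will be applied to the resulting word
    and needs an assignment into its universe.\<close>
  define \<C> :: "('p, nat) struct set" where "\<C> = {word m w |m w. 0 < m}"
  obtain \<psi> where \<psi>: "sentence \<Theta> \<psi>"
    and sat_\<psi>: "\<And>(M :: ('p, nat) struct) e. sat M e \<psi> \<longleftrightarrow> (\<exists>N\<in>\<C>. back_forth \<Theta> M N n {})"
    using definable_union_of_classes[of Ps \<C> n] unfolding Ps by blast
  define \<delta> where "\<delta> = relle 0 \<psi>"
  \<comment> \<open>Index \<open>0\<close> now ranges over the set defined by \<delta>, and
    \<open>1\<close> is the free variable: \<epsilon> defines the strict upper bounds of that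
    set.\<close>
  define \<epsilon> where "\<epsilon> = All (Imp \<delta> (Less 0 1))"
  define P :: 'p where "P = undefined"
  have \<delta>: "fv \<delta> \<subseteq> {0}" "preds \<delta> \<subseteq> \<Theta>"
    using \<psi> fv_relle[of 0 \<psi>] by (auto simp: \<delta>_def sentence_def)
  then have \<epsilon>: "fv \<epsilon> \<subseteq> {0}" "preds \<epsilon> \<subseteq> \<Theta>" by (auto simp: \<epsilon>_def)
  let ?s = "select P \<delta> \<epsilon>"
  have s: "fv ?s \<subseteq> {0}" "preds ?s \<subseteq> \<Theta>" using select_syntax[OF \<delta>(1) \<epsilon>(1) \<delta>(2) \<epsilon>(2)] by auto
  have top: "fv (Top :: 'p fm) \<subseteq> {0}" "preds (Top :: 'p fm) \<subseteq> \<Theta>" by auto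
  show thesis
  proof (rule that)
    \<comment> \<open>The candidates are tried in the order universe, set of \<delta>, set of
      \<epsilon>.\<close>
    show "fv (select P Top ?s) \<subseteq> {0}" "preds (select P Top ?s) \<subseteq> \<Theta>"
      using select_syntax[OF top(1) s(1) top(2) s(2)] by auto
    fix M :: "('p, nat) struct"
    assume M: "is_model \<Theta> M {\<alpha>}"
    then have ne: "univ M \<noteq> {}" by (simp add: is_model_def is_struct_def)
    then obtain a where "a \<in> univ M" by blast
    then have e: "range (\<lambda>_::nat. a) \<subseteq> univ M" by blast
    with M have sat: "sat M (\<lambda>_. a) \<alpha>" by (simp add: is_model_def)
    with LIN have "\<forall>\<phi>\<in>LIN_ax. sat M (\<lambda>_. a) \<phi>"
      using soundness[OF _ e, of "{\<alpha>}"] by (auto simp: derives_theory_def)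
    then have lin: "lin_ord (univ M) (lt M)" by (simp add: sat_LIN_iff)
    define K where "K Y \<longleftrightarrow> (\<exists>N\<in>\<C>. back_forth \<Theta> (M\<lparr>univ := Y\<rparr>) N n {})" for Y
    define D where "D = {v \<in> univ M. K (below (lt M) (univ M) v)}"
    have sat_\<delta>: "sat M e \<delta> \<longleftrightarrow> K (below (lt M) (univ M) (e 0))" for e
      by (simp add: \<delta>_def sat_relle sat_\<psi> K_def)
    have sets: "defset M Top = univ M" "defset M \<delta> = D"
      "defset M \<epsilon> = {v \<in> univ M. \<forall>u\<in>D. (u, v) \<in> lt M}"
      by (auto simp: defset_def sat_\<delta> \<epsilon>_def D_def)
    show "unbounded (defset M (select P Top ?s)) (lt M)"
    proof (rule ccontr)
      assume "\<not> ?thesis"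
      then have not_unb: "\<not> unbounded (univ M) (lt M)" "\<not> unbounded D (lt M)"
        "\<not> unbounded {v \<in> univ M. \<forall>u\<in>D. (u, v) \<in> lt M} (lt M)"
        using unbounded_select[OF top(1), of M ?s P] unbounded_select[OF \<delta>(1), of M \<epsilon> P]
        unfolding sets by blast+
      have "K (univ M)"
      proof (rule bounded_induct[OF lin ne _ D_def not_unb])
        fix p Y
        assume p: "p \<in> univ M" and Y: "Y \<subseteq> univ M" "\<And>y. y \<in> Y \<Longrightarrow> (y, p) \<in> lt M"
          and KY: "Y = {} \<or> K Y"
        \<comment> \<open>An empty \<open>Y\<close> is matched with the word of length
          \<open>0\<close>; after the top point is added, the length is positive in either
          case.\<close>
        obtain m w where bf: "back_forth \<Theta> (M\<lparr>univ := Y\<rparr>) (word m w) n {}"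
        proof (cases "Y = {}")
          case True
          then have "back_forth \<Theta> (M\<lparr>univ := Y\<rparr>) (word 0 (\<lambda>_. {})) n {}"
            by (intro back_forth_empty) (auto simp: word_def)
          then show thesis by (rule that)
        next
          case False
          with KY show thesis using that unfolding K_def \<C>_def by blast
        qed
        \<comment> \<open>The map \<open>w\<close> may already contain the position
          \<open>m\<close>; that label is erased before the label of \<open>p\<close> is copied
          there.\<close>
        define w' where "w' Q = {i \<in> w Q. i < m} \<union> (if p \<in> the (prd M Q) then {m} else {})" for Q
        have irr: "(p, p) \<notin> lt M" using lin p by (simp add: lin_ord_def)
        have asym: "(p, y) \<notin> lt M" if "y \<in> Y" for y
          using lin p irr Y(1) Y(2)[OF that] that unfolding lin_ord_def by blast
        have "add_top (M\<lparr>univ := Y\<rparr>) p (M\<lparr>univ := insert p Y\<rparr>)"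
          using irr asym Y(2) by (auto simp: add_top_def)
        moreover have "add_top (word m w) m (word (Suc m) w')"
          by (auto simp: add_top_def word_def w'_def)
        moreover have "p \<in> the (prd (M\<lparr>univ := insert p Y\<rparr>) Q) \<longleftrightarrow>
            m \<in> the (prd (word (Suc m) w') Q)" for Q
          by (simp add: word_def w'_def)
        ultimately have "back_forth \<Theta> (M\<lparr>univ := insert p Y\<rparr>) (word (Suc m) w') n {(p, m)}"
          using back_forth_add_top[OF bf] by simp
        \<comment> \<open>Forgetting the pair of top points returns to the empty position, as
          \<open>K\<close> requires.\<close>
        then have "back_forth \<Theta> (M\<lparr>univ := insert p Y\<rparr>) (word (Suc m) w') n {}"
          by (rule back_forth_subset) simp
        then show "K (insert p Y)" unfolding K_def \<C>_def by blast
      qed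
      then obtain m w where "0 < m" "back_forth \<Theta> M (word m w) n {}"
        unfolding K_def \<C>_def by auto
      moreover have "fv \<alpha> = {}" "preds \<alpha> \<subseteq> \<Theta>" using \<alpha> by (auto simp: sentence_def)
      \<comment> \<open>A finite model of \<alpha> contradicts the derivability of infinity.\<close>
      ultimately have "sat (word m w) (\<lambda>_. 0) \<alpha>"
        using sat back_forth_sat[of \<Theta> M "word m w" n "{}" \<alpha> "\<lambda>_. a" "\<lambda>_. 0"] by (simp add: n_def)
      moreover have "range (\<lambda>_. 0) \<subseteq> univ (word m w)" using \<open>0 < m\<close> by (auto simp: word_def)
      ultimately have "\<forall>\<phi>\<in>INF_ax. sat (word m w) (\<lambda>_. 0) \<phi>"
        using INF soundness[of "{\<alpha>}" _ "\<lambda>_. 0" "word m w"] by (auto simp: derives_theory_def)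
      then show False unfolding sat_INF_iff by (simp add: word_def)
    qed
  qed
qed

section \<open>The expansion of models and the interpretation\<close>

theorem theorem5p1:
  fixes \<Theta> :: "'p set" and P :: 'p and A :: "'p fm"
  assumes "finite \<Theta>" and "P \<in> \<Theta>"
    and "sentence {} A" and "{A} \<tturnstile> LIN_ax"
    and U_def: "U = {A} \<union> INF_ax"
    and \<alpha>star_def: "\<alpha>star = And A (UB P)"
  shows "({\<alpha>star} \<tturnstile> U \<and>
      (\<forall>M :: ('p, 'm) struct. is_model {} M U \<longrightarrow>
        (\<exists>N. expands_to M N \<and> is_model \<Theta> N {\<alpha>star}))) \<and>
    (\<forall>\<alpha>. sentence \<Theta> \<alpha> \<longrightarrow> {\<alpha>} \<tturnstile> U \<longrightarrow> pf_interprets \<Theta> {\<alpha>} {\<alpha>star})"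
proof (intro conjI allI impI)
  have A: "preds A = {}" "fv A = {}" using \<open>sentence {} A\<close> by (auto simp: sentence_def)
  have sent_star: "sentence \<Theta> \<alpha>star"
    using A \<open>P \<in> \<Theta>\<close> by (auto simp: \<alpha>star_def sentence_def UB_def)
  have lin: "lin_ord (univ N) (lt N)" if "range e \<subseteq> univ N" "sat N e A" for N :: "('p, 'n) struct" and e
    using soundness[OF _ that(1), of "{A}"] that(2) \<open>{A} \<tturnstile> LIN_ax\<close> sat_LIN_iff[of N e]
    by (simp add: derives_theory_def)
  show "{\<alpha>star} \<tturnstile> U"
    unfolding derives_theory_def
  proof
    fix \<phi> assume \<phi>: "\<phi> \<in> U"
    show "{\<alpha>star} \<turnstile> \<phi>"
    proof (rule completeness[OF countable_finite[OF \<open>finite \<Theta>\<close>]])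
      show "sentence \<Theta> \<psi>" if "\<psi> \<in> {\<alpha>star}" for \<psi> using that sent_star by simp
      show "sentence \<Theta> \<phi>"
        using \<phi> A sentence_at_least[of \<Theta>] by (auto simp: U_def INF_ax_def sentence_def)
      fix M :: "('p, nat) struct" assume M: "is_model \<Theta> M {\<alpha>star}"
      have "sat M e \<phi>" if e: "range e \<subseteq> univ M" for e
      proof -
        have sat: "sat M e A" "sat M e (UB P)" using M e by (auto simp: is_model_def \<alpha>star_def)
        then have "infinite (univ M)"
          using infinite_unbounded[OF lin[OF e]] by (auto simp: sat_UB)
        then show ?thesis using \<phi> sat(1) sat_INF_iff[of M e] by (auto simp: U_def)
      qed
      with M show "is_model \<Theta> M {\<phi>}" by (simp add: is_model_def)
    qed
  qed
next
  fix M :: "('p, 'm) struct" assume M: "is_model {} M U"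
  have preds_A: "preds A = {}" using \<open>sentence {} A\<close> by (simp add: sentence_def)
  from M obtain a where "a \<in> univ M" by (auto simp: is_model_def is_struct_def)
  then have e: "range (\<lambda>_::nat. a) \<subseteq> univ M" by blast
  have satU: "sat M (\<lambda>_. a) \<phi>" if "\<phi> \<in> U" for \<phi>
    using M e that by (auto simp: is_model_def)
  have "\<forall>\<phi>\<in>LIN_ax. sat M (\<lambda>_. a) \<phi>"
    using soundness[OF _ e, of "{A}"] satU[of A] \<open>{A} \<tturnstile> LIN_ax\<close>
    by (simp add: derives_theory_def U_def)
  then have lin: "lin_ord (univ M) (lt M)" by (simp add: sat_LIN_iff)
  have "\<forall>\<phi>\<in>INF_ax. sat M (\<lambda>_. a) \<phi>" using satU by (simp add: U_def)
  then have "infinite (univ M)" by (simp add: sat_INF_iff)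
  with lin obtain Y where Y: "Y \<subseteq> univ M" "unbounded Y (lt M)" by (rule infinite_has_unbounded)
  \<comment> \<open>Every symbol of \<Theta> must receive a value; giving all of them
    \<open>Y\<close> is one choice that makes \<open>P\<close> right.\<close>
  let ?N = "M\<lparr>prd := \<lambda>Q. if Q \<in> \<Theta> then Some Y else None\<rparr>"
  have "prd M = Map.empty" using M by (auto simp: is_model_def is_struct_def)
  then have "expands_to M ?N" by (simp add: expands_to_def)
  moreover have "is_model \<Theta> ?N {\<alpha>star}"
  proof -
    have "is_struct \<Theta> ?N"
      using M Y(1) by (auto simp: is_model_def is_struct_def dom_def ran_def split: if_splits)
    moreover have "sat ?N e \<alpha>star" if "range e \<subseteq> univ M" for e
    proof -
      have "sat M e A" using M that by (auto simp: is_model_def U_def)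
      moreover have "univ M \<inter> Y = Y" using Y(1) by blast
      ultimately show ?thesis
        using Y(2) preds_A \<open>P \<in> \<Theta>\<close> by (simp add: \<alpha>star_def sat_UB sat_reduct)
    qed
    ultimately show ?thesis by (simp add: is_model_def)
  qed
  ultimately show "\<exists>N. expands_to M N \<and> is_model \<Theta> N {\<alpha>star}" by blast
next
  fix \<alpha> assume \<alpha>: "sentence \<Theta> \<alpha>" "{\<alpha>} \<tturnstile> U"
  have preds_A: "preds A = {}" using \<open>sentence {} A\<close> by (simp add: sentence_def)
  have \<alpha>A: "{\<alpha>} \<turnstile> A" and INF: "{\<alpha>} \<tturnstile> INF_ax" using \<alpha>(2) by (auto simp: derives_theory_def U_def)
  \<comment> \<open>A cut on \<open>A\<close>, done syntactically through the implication.\<close>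
  have "{\<alpha>} \<turnstile> \<phi>" if "\<phi> \<in> LIN_ax" for \<phi>
  proof (rule ImpE[OF _ \<alpha>A])
    have "{A} \<turnstile> \<phi>" using \<open>{A} \<tturnstile> LIN_ax\<close> that by (simp add: derives_theory_def)
    then have "{} \<turnstile> Imp A \<phi>" by (rule ImpI)
    then show "{\<alpha>} \<turnstile> Imp A \<phi>" by (rule weakening) simp
  qed
  then have LIN: "{\<alpha>} \<tturnstile> LIN_ax" by (simp add: derives_theory_def)
  obtain \<delta> where \<delta>: "fv \<delta> \<subseteq> {0}" "preds \<delta> \<subseteq> \<Theta>"
    and unb: "\<And>M :: ('p, nat) struct. is_model \<Theta> M {\<alpha>} \<Longrightarrow> unbounded (defset M \<delta>) (lt M)"
    using definable_unbounded[OF \<open>finite \<Theta>\<close> \<alpha>(1) LIN INF] by blast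
  \<comment> \<open>Only the image of \<open>P\<close> matters for \<open>\<alpha>star\<close>, so
    one formula serves for all symbols.\<close>
  let ?\<tau> = "\<lambda>_. \<delta>"
  have "{\<alpha>} \<turnstile> translate ?\<tau> \<gamma>" if \<gamma>: "sentence \<Theta> \<gamma>" "{\<alpha>star} \<turnstile> \<gamma>" for \<gamma>
  proof (rule completeness[OF countable_finite[OF \<open>finite \<Theta>\<close>]])
    show "sentence \<Theta> \<psi>" if "\<psi> \<in> {\<alpha>}" for \<psi> using that \<alpha>(1) by simp
    show "sentence \<Theta> (translate ?\<tau> \<gamma>)"
      using \<gamma>(1) \<delta> fv_translate[of \<gamma> ?\<tau>] preds_translate[of \<gamma> ?\<tau> \<Theta>] by (auto simp: sentence_def)
    fix M :: "('p, nat) struct" assume M: "is_model \<Theta> M {\<alpha>}"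
    let ?I = "\<lambda>Q. Some {a. sat M (\<lambda>_. a) \<delta>}"
    have "sat M e (translate ?\<tau> \<gamma>)" if e: "range e \<subseteq> univ M" for e
    proof -
      have "sat M e A" using M e soundness[OF \<alpha>A e] by (simp add: is_model_def)
      moreover have "univ M \<inter> {a. sat M (\<lambda>_. a) \<delta>} = defset M \<delta>" by (auto simp: defset_def)
      \<comment> \<open>Reinterpreting the symbols does not affect \<open>A\<close>, which contains
        none of them, and makes \<open>P\<close> an unbounded set.\<close>
      ultimately have "sat (M\<lparr>prd := ?I\<rparr>) e \<alpha>star"
        using unb[OF M] preds_A by (simp add: \<alpha>star_def sat_UB sat_reduct)
      then have "sat (M\<lparr>prd := ?I\<rparr>) e \<gamma>" using e by (intro soundness[OF \<gamma>(2)]) auto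
      then show ?thesis using sat_translate[of \<gamma> ?\<tau> M e] \<delta>(1) by simp
    qed
    with M show "is_model \<Theta> M {translate ?\<tau> \<gamma>}" by (simp add: is_model_def)
  qed
  then show "pf_interprets \<Theta> {\<alpha>} {\<alpha>star}"
    using \<delta> unfolding pf_interprets_def pf_translation_def by (intro exI[of _ ?\<tau>]) simp
qed

end
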